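(* Let $M,N,\chi,L_x,L_y>0$ be real and $m,n$ positive integers, with the associated grid, operators and functions $S,H,\kappa$ described in the context. Then for every time step $s>0$ the following scheme is uniquely solvable: for every periodic $\phi^k\in\mathcal{C}_{\overline m\times\overline n}$ with values in $(0,1/\rho)$ there exists exactly one periodic $\phi^{k+1}\in\mathcal{C}_{\overline m\times\overline n}$ with values in $(0,1/\rho)$ such that, on $C_m\times C_n$, $$\phi^{k+1}-\phi^k=s\,\Delta_h\mu^{k+1},$$ where $$\mu^{k+1}=S'(\phi^{k+1})+\kappa'(\phi^{k+1})\big(a_x((D_x\phi^{k+1})^2)+a_y((D_y\phi^{k+1})^2)\big)-2d_x\big(A_x\kappa(\phi^{k+1})\,D_x\phi^{k+1}\big)-2d_y\big(A_y\kappa(\phi^{k+1})\,D_y\phi^{k+1}\big)+H'(\phi^k)$$ on $C_m\times C_n$, and $\mu^{k+1}$ is extended periodically to $C_{\overline m}\times C_{\overline n}$ so that $\Delta_h\mu^{k+1}$ is defined.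
   Context: Parameters: $\alpha=\pi\big(\sqrt{M/\pi}+N/2\big)^2$, $\beta=\alpha/\sqrt{\pi M}$, $\tau=\sqrt{\pi M}\,N$, $\rho=1+M/\tau$. For $\phi\in(0,1/\rho)\subset(0,1)$: $S(\phi)=\frac{\phi}{\tau}\ln\frac{\alpha\phi}{\tau}+\frac{\phi}{N}\ln\frac{\beta\phi}{\tau}+(1-\rho\phi)\ln(1-\rho\phi)$, $H(\phi)=\chi\phi(1-\rho\phi)$, $\kappa(\phi)=\frac{1}{36\phi(1-\phi)}$. Additive constants in $S'$ and $H'$ are dropped in the scheme (they are annihilated by $\Delta_h$), so in the scheme $S'(\phi)=\big(\frac1\tau+\frac1N\big)\ln\phi-\rho\ln(1-\rho\phi)$, $H'(\phi)=-2\chi\rho\phi$, $\kappa'(\phi)=\frac{2\phi-1}{36\phi^2(1-\phi)^2}$. Grid: $h_x=L_x/m$, $h_y=L_y/n$; $x_i=(i-\frac12)h_x$, $y_j=(j-\frac12)h_y$ (for integer or half-integer indices). $C_m=\{x_i: 1\le i\le m\}$, $C_{\overline m}=\{x_i: 0\le i\le m+1\}$, $E_m=\{x_{i+1/2}:0\le i\le m\}$; similarly $C_n,C_{\overline n},E_n$ in $y$. $\mathcal{C}_{\overline m\times\overline n}$ is the space of functions $\phi:C_{\overline m}\times C_{\overline n}\to\mathbb{R}$, $\phi_{i,j}=\phi(x_i,y_j)$. Such $\phi$ is periodic if $\phi_{m+1,j}=\phi_{1,j}$, $\phi_{0,j}=\phi_{m,j}$ for $1\le j\le n$ and $\phi_{i,n+1}=\phi_{i,1}$,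 $\phi_{i,0}=\phi_{i,n}$ for $0\le i\le m+1$. Operators. For $f$ defined on $E_m\times C_n$: $a_xf_{i,j}=\frac12(f_{i+\frac12,j}+f_{i-\frac12,j})$, $d_xf_{i,j}=\frac1{h_x}(f_{i+\frac12,j}-f_{i-\frac12,j})$, $1\le i\le m$, $1\le j\le n$. For $g$ defined on $C_m\times E_n$: $a_yg_{i,j}=\frac12(g_{i,j+\frac12}+g_{i,j-\frac12})$, $d_yg_{i,j}=\frac1{h_y}(g_{i,j+\frac12}-g_{i,j-\frac12})$. For $\phi\in\mathcal{C}_{\overline m\times\overline n}$: $A_x\phi_{i+\frac12,j}=\frac12(\phi_{i+1,j}+\phi_{i,j})$, $D_x\phi_{i+\frac12,j}=\frac1{h_x}(\phi_{i+1,j}-\phi_{i,j})$ for $0\le i\le m$, $1\le j\le n$; $A_y\phi_{i,j+\frac12}=\frac12(\phi_{i,j+1}+\phi_{i,j})$, $D_y\phi_{i,j+\frac12}=\frac1{h_y}(\phi_{i,j+1}-\phi_{i,j})$ for $1\le i\le m$, $0\le j\le n$; and $\Delta_h\phi_{i,j}=d_x(D_x\phi)_{i,j}+d_y(D_y\phi)_{i,j}$ for $1\le i\le m$, $1\le j\le n$. Products, squares and compositions with scalar functions are taken pointwise. *)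

theory Defs
  imports Complex_Main "HOL-Library.FuncSet"
begin

definition tau :: "real \<Rightarrow> real \<Rightarrow> real" where
  "tau M N = sqrt (pi * M) * N"

definition alpha :: "real \<Rightarrow> real \<Rightarrow> real" where
  "alpha M N = pi * (sqrt (M / pi) + N / 2)\<^sup>2"

definition beta :: "real \<Rightarrow> real \<Rightarrow> real" where
  "beta M N = alpha M N / sqrt (pi * M)"

definition rho :: "real \<Rightarrow> real \<Rightarrow> real" where
  "rho M N = 1 + M / tau M N"

definition S_fun :: "real \<Rightarrow> real \<Rightarrow> real \<Rightarrow> real" where
  "S_fun M N x =
     x / tau M N * ln (alpha M N * x / tau M N)
     + x / N * ln (beta M N * x / tau M N)
     + (1 - rho M N * x) * ln (1 - rho M N * x)"

definition H_fun :: "real \<Rightarrow> real \<Rightarrow> real \<Rightarrow> real \<Rightarrow> real" where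
  "H_fun M N \<chi> x = \<chi> * x * (1 - rho M N * x)"

definition kappa :: "real \<Rightarrow> real" where
  "kappa x = 1 / (36 * x * (1 - x))"

text \<open>
  The scheme uses the derivatives of \<open>S_fun\<close> and \<open>H_fun\<close> with their additive constants
  dropped; these constants are annihilated by the discrete Laplacian.  The lemmas below
  record that \<open>S_der\<close> and \<open>H_der\<close> are the derivatives up to such a constant, and
  that \<open>kappa_der\<close> is exactly the derivative of \<open>kappa\<close>.
\<close>

definition S_der :: "real \<Rightarrow> real \<Rightarrow> real \<Rightarrow> real" where
  "S_der M N x = (1 / tau M N + 1 / N) * ln x - rho M N * ln (1 - rho M N * x)"

definition H_der :: "real \<Rightarrow> real \<Rightarrow> real \<Rightarrow> real \<Rightarrow> real" where
  "H_der M N \<chi> x = - 2 * \<chi> * rho M N * x"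

definition kappa_der :: "real \<Rightarrow> real" where
  "kappa_der x = (2 * x - 1) / (36 * x\<^sup>2 * (1 - x)\<^sup>2)"

lemma S_fun_has_derivative:
  assumes "M > 0" "N > 0" "0 < x" "x < 1 / rho M N"
  shows "(S_fun M N has_real_derivative
            S_der M N x
            + ((ln (alpha M N / tau M N) + 1) / tau M N
               + (ln (beta M N / tau M N) + 1) / N - rho M N)) (at x)"
proof -
  have t: "tau M N > 0" using assms by (simp add: tau_def)
  then have r: "rho M N > 0" using assms by (simp add: rho_def add_pos_pos)
  have "sqrt (M / pi) + N / 2 > 0" using assms by (intro add_pos_pos) simp_all
  then have a: "alpha M N > 0" by (simp add: alpha_def)
  then have b: "beta M N > 0" using assms by (simp add: beta_def)
  have rx: "1 - rho M N * x > 0" using r assms by (simp add: field_simps)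
  have ent: "((\<lambda>x. x / d * ln (c * x / e)) has_real_derivative (ln x + (ln (c / e) + 1)) / d) (at x)"
    if "c > 0" "d > 0" "e > 0" for c d e :: real
  proof -
    have l: "ln (c * x / e) = ln (c / e) + ln x"
      using ln_mult [of "c / e" x] that assms by simp
    show ?thesis
      by (rule derivative_eq_intros refl | use that assms in \<open>simp; fail\<close>)+
         (use that assms in \<open>simp add: l add_divide_distrib\<close>)
  qed
  have mix: "((\<lambda>x. (1 - rho M N * x) * ln (1 - rho M N * x)) has_real_derivative
               - rho M N * ln (1 - rho M N * x) - rho M N) (at x)"
    using rx by (auto intro!: derivative_eq_intros)
  show ?thesis
    unfolding S_fun_def [abs_def]
    by (rule DERIV_cong [OF DERIV_add [OF DERIV_add [OF
          ent [OF a t t] ent [OF b assms(2) t]] mix]])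
       (simp add: S_der_def add_divide_distrib distrib_right)
qed

lemma H_fun_has_derivative:
  "(H_fun M N \<chi> has_real_derivative H_der M N \<chi> x + \<chi>) (at x)"
  unfolding H_fun_def [abs_def] H_der_def
  by (rule derivative_eq_intros refl)+ (simp add: algebra_simps)

lemma kappa_has_derivative:
  assumes "0 < x" "x < 1"
  shows "(kappa has_real_derivative kappa_der x) (at x)"
proof -
  have nz: "36 * x * (1 - x) \<noteq> 0" using assms by simp
  have "((\<lambda>x. 36 * x * (1 - x)) has_real_derivative 36 * (1 - x) - 36 * x) (at x)"
    by (auto intro!: derivative_eq_intros)
  then have "((\<lambda>x. 1 / (36 * x * (1 - x))) has_real_derivative
      (0 * (36 * x * (1 - x)) - 1 * (36 * (1 - x) - 36 * x))
        / ((36 * x * (1 - x)) * (36 * x * (1 - x)))) (at x)"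
    by (intro DERIV_divide DERIV_const nz)
  moreover have "0 * (36 * x * (1 - x)) - 1 * (36 * (1 - x) - 36 * x) = 36 * (2 * x - 1)"
    by simp
  moreover have "(36 * x * (1 - x)) * (36 * x * (1 - x)) = 36 * (36 * x\<^sup>2 * (1 - x)\<^sup>2)"
    by (simp only: power2_eq_square mult_ac)
  ultimately show ?thesis
    by (simp only: kappa_def [abs_def] kappa_der_def mult_divide_mult_cancel_left)
qed

text \<open>
  Grid points are identified with their indices: the cell centre \<open>(x\<^sub>i, y\<^sub>j)\<close> is the
  pair \<open>(i, j)\<close>, and an edge point with first (second) index \<open>i + 1/2\<close> (\<open>j + 1/2\<close>)
  is stored under \<open>i\<close> (\<open>j\<close>).  Hence the edge point with index \<open>i - 1/2\<close> is stored under
  \<open>i - 1\<close>; the natural-number subtraction is harmless since the operators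
  \<open>ax\<close>, \<open>dx\<close>, \<open>ay\<close>, \<open>dy\<close> are only evaluated at indices \<open>\<ge> 1\<close>.
\<close>

definition cells :: "nat \<Rightarrow> nat \<Rightarrow> (nat \<times> nat) set" where
  "cells m n = {1..m} \<times> {1..n}"

definition cells_bar :: "nat \<Rightarrow> nat \<Rightarrow> (nat \<times> nat) set" where
  "cells_bar m n = {0..m+1} \<times> {0..n+1}"

text \<open>
  Functions on the extended grid are taken extensionally (\<open>undefined\<close> off the grid), so that
  HOL equality is equality of grid functions.
\<close>

definition grid_functions :: "nat \<Rightarrow> nat \<Rightarrow> (nat \<times> nat \<Rightarrow> real) set" where
  "grid_functions m n = cells_bar m n \<rightarrow>\<^sub>E UNIV"

definition periodic :: "nat \<Rightarrow> nat \<Rightarrow> (nat \<times> nat \<Rightarrow> real) \<Rightarrow> bool" where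
  "periodic m n \<phi> \<longleftrightarrow>
     (\<forall>j\<in>{1..n}. \<phi> (m + 1, j) = \<phi> (1, j) \<and> \<phi> (0, j) = \<phi> (m, j)) \<and>
     (\<forall>i\<in>{0..m+1}. \<phi> (i, n + 1) = \<phi> (i, 1) \<and> \<phi> (i, 0) = \<phi> (i, n))"

definition ax :: "(nat \<times> nat \<Rightarrow> real) \<Rightarrow> nat \<times> nat \<Rightarrow> real" where
  "ax f = (\<lambda>(i, j). (f (i, j) + f (i - 1, j)) / 2)"

definition dx :: "real \<Rightarrow> (nat \<times> nat \<Rightarrow> real) \<Rightarrow> nat \<times> nat \<Rightarrow> real" where
  "dx hx f = (\<lambda>(i, j). (f (i, j) - f (i - 1, j)) / hx)"

definition ay :: "(nat \<times> nat \<Rightarrow> real) \<Rightarrow> nat \<times> nat \<Rightarrow> real" where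
  "ay g = (\<lambda>(i, j). (g (i, j) + g (i, j - 1)) / 2)"

definition dy :: "real \<Rightarrow> (nat \<times> nat \<Rightarrow> real) \<Rightarrow> nat \<times> nat \<Rightarrow> real" where
  "dy hy g = (\<lambda>(i, j). (g (i, j) - g (i, j - 1)) / hy)"

definition Ax :: "(nat \<times> nat \<Rightarrow> real) \<Rightarrow> nat \<times> nat \<Rightarrow> real" where
  "Ax \<phi> = (\<lambda>(i, j). (\<phi> (i + 1, j) + \<phi> (i, j)) / 2)"

definition Dx :: "real \<Rightarrow> (nat \<times> nat \<Rightarrow> real) \<Rightarrow> nat \<times> nat \<Rightarrow> real" where
  "Dx hx \<phi> = (\<lambda>(i, j). (\<phi> (i + 1, j) - \<phi> (i, j)) / hx)"

definition Ay :: "(nat \<times> nat \<Rightarrow> real) \<Rightarrow> nat \<times> nat \<Rightarrow> real" where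
  "Ay \<phi> = (\<lambda>(i, j). (\<phi> (i, j + 1) + \<phi> (i, j)) / 2)"

definition Dy :: "real \<Rightarrow> (nat \<times> nat \<Rightarrow> real) \<Rightarrow> nat \<times> nat \<Rightarrow> real" where
  "Dy hy \<phi> = (\<lambda>(i, j). (\<phi> (i, j + 1) - \<phi> (i, j)) / hy)"

definition laplace_h :: "real \<Rightarrow> real \<Rightarrow> (nat \<times> nat \<Rightarrow> real) \<Rightarrow> nat \<times> nat \<Rightarrow> real" where
  "laplace_h hx hy \<phi> p = dx hx (Dx hx \<phi>) p + dy hy (Dy hy \<phi>) p"

text \<open>
  The chemical potential at a point of \<open>cells m n\<close>; \<open>\<phi>\<close> is the old and \<open>\<psi>\<close> the new
  time level.
\<close>

definition chem_pot ::
  "real \<Rightarrow> real \<Rightarrow> real \<Rightarrow> real \<Rightarrow> real \<Rightarrow> (nat \<times> nat \<Rightarrow> real) \<Rightarrow> (nat \<times> nat \<Rightarrow> real)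
     \<Rightarrow> nat \<times> nat \<Rightarrow> real" where
  "chem_pot M N \<chi> hx hy \<phi> \<psi> p =
     S_der M N (\<psi> p)
     + kappa_der (\<psi> p) * (ax (\<lambda>e. (Dx hx \<psi> e)\<^sup>2) p + ay (\<lambda>e. (Dy hy \<psi> e)\<^sup>2) p)
     - 2 * dx hx (\<lambda>e. Ax (kappa \<circ> \<psi>) e * Dx hx \<psi> e) p
     - 2 * dy hy (\<lambda>e. Ay (kappa \<circ> \<psi>) e * Dy hy \<psi> e) p
     + H_der M N \<chi> (\<phi> p)"

end

theory Submission
  imports Defs "HOL-Analysis.Function_Topology"
begin

text \<open>
  The implicit part of the chemical potential is the derivative of a convex energy, since
  \<open>1 / kappa\<close> is concave; it is thus a monotone map, strictly so because of \<open>S_der\<close>, and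
  pairing the difference of two solutions with the difference of their potentials gives
  uniqueness. For existence write \<open>\<psi> = \<phi> + div g\<close> with a flux \<open>g\<close> on the edges and minimise
  \<open>(\<Sum>e. (g e)\<^sup>2) / (2 s) + energy (\<phi> + div g)\<close>: the Euler-Lagrange equation
  \<open>g = s grad \<mu>\<close> is the scheme, so that no inverse of the Laplacian and no mass constraint are
  needed. The minimum is taken over fluxes that keep \<open>\<psi>\<close> in \<open>[\<delta>, 1 / \<rho> - \<delta>]\<close>. If a minimiser
  touched this constraint, then moving mass from a maximum point of \<open>\<psi>\<close> to a minimum point would
  lower the energy for small \<open>\<delta>\<close>, by the logarithmic singularities of \<open>S_der\<close>. Only the
  incidence structure of the grid matters, so the argument is carried out on a connected graph.
\<close>

section \<open>Convexity of the interfacial energy density\<close>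

lemma kappa_pos: "0 < x \<Longrightarrow> x < 1 \<Longrightarrow> 0 < kappa x"
  by (simp add: kappa_def)

text \<open>Partial fractions give \<open>36 * kappa x = 1 / x + 1 / (1 - x)\<close>; the
  derivatives of both terms increase on the unit interval.\<close>

lemma kappa_der_mono:
  assumes "0 < x" "x \<le> y" "y < 1"
  shows "kappa_der x \<le> kappa_der y"
proof -
  have eq: "kappa_der t = (inverse ((1 - t)\<^sup>2) - inverse (t\<^sup>2)) / 36" if "0 < t" "t < 1" for t
  proof -
    have "2 * t - 1 = t\<^sup>2 - (1 - t)\<^sup>2" by (simp add: power2_eq_square algebra_simps)
    then show ?thesis
      using that by (simp add: kappa_der_def divide_simps)
  qed
  have "inverse ((1 - x)\<^sup>2) \<le> inverse ((1 - y)\<^sup>2)" "inverse (y\<^sup>2) \<le> inverse (x\<^sup>2)"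
    using assms by (auto intro!: le_imp_inverse_le power_mono)
  then have "inverse ((1 - x)\<^sup>2) - inverse (x\<^sup>2) \<le> inverse ((1 - y)\<^sup>2) - inverse (y\<^sup>2)"
    by (rule diff_mono)
  moreover have "kappa_der x = (inverse ((1 - x)\<^sup>2) - inverse (x\<^sup>2)) / 36"
    "kappa_der y = (inverse ((1 - y)\<^sup>2) - inverse (y\<^sup>2)) / 36"
    using assms by (intro eq; simp)+
  ultimately show ?thesis by (simp only: divide_right_mono)
qed

text \<open>With \<open>W x = 36 x (1 - x)\<close> concave, \<open>(x, y) \<mapsto> (x - y)\<^sup>2 / W x\<close> is convex, because
  \<open>(d, W) \<mapsto> d\<^sup>2 / W\<close> is convex and decreasing in \<open>W\<close>.\<close>

lemma kappa_edge_convex: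
  assumes "0 < x" "x < 1" "0 < x'" "x' < 1"
  shows "kappa x * (x - y)\<^sup>2 + kappa_der x * (x - y)\<^sup>2 * (x' - x)
           + 2 * kappa x * (x - y) * ((x' - y') - (x - y))
         \<le> kappa x' * (x' - y')\<^sup>2"
proof -
  define W W' r where "W = 36 * x * (1 - x)" and "W' = 36 * x' * (1 - x')" and "r = (x - y) / W"
  have pos: "W > 0" "W' > 0" using assms by (auto simp: W_def W'_def)
  have k: "kappa x = 1 / W" "kappa x' = 1 / W'" by (auto simp: kappa_def W_def W'_def)
  have d: "x - y = r * W" using pos by (simp add: r_def)
  have kd: "kappa_der x = 36 * (2 * x - 1) / W\<^sup>2"
  proof -
    have "W\<^sup>2 = 36 * (36 * x\<^sup>2 * (1 - x)\<^sup>2)" by (simp add: W_def power_mult_distrib)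
    moreover have "36 * (2 * x - 1) / (36 * (36 * x\<^sup>2 * (1 - x)\<^sup>2)) = kappa_der x"
      unfolding kappa_der_def by (rule mult_divide_mult_cancel_left) simp
    ultimately show ?thesis by simp
  qed
  have conc: "W' \<le> W + 36 * (1 - 2 * x) * (x' - x)"
  proof -
    have "W + 36 * (1 - 2 * x) * (x' - x) - W' = 36 * (x' - x)\<^sup>2"
      by (simp add: W_def W'_def power2_eq_square algebra_simps)
    then show ?thesis by (smt (verit) zero_le_power2)
  qed
  \<comment> \<open>Completing the square puts \<open>2 * r * d - r\<^sup>2 * W'\<close> below
    \<open>d\<^sup>2 / W'\<close>; with \<open>r = (x - y) / W\<close> this is the tangent plane at
    \<open>(x - y, W)\<close>. Replacing \<open>W'\<close> by its upper bound from
    \<open>conc\<close> only lowers it.\<close>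
  have "0 \<le> ((x' - y') - r * W')\<^sup>2 / W'" using pos by simp
  also have "\<dots> = (x' - y')\<^sup>2 / W' - 2 * r * (x' - y') + r\<^sup>2 * W'"
    using pos by (simp add: field_simps power2_eq_square)
  finally have "2 * r * (x' - y') - r\<^sup>2 * W' \<le> kappa x' * (x' - y')\<^sup>2"
    using k by simp
  moreover have "r\<^sup>2 * W' \<le> r\<^sup>2 * (W + 36 * (1 - 2 * x) * (x' - x))"
    by (intro mult_left_mono conc) simp
  moreover have "kappa x * (x - y)\<^sup>2 + kappa_der x * (x - y)\<^sup>2 * (x' - x)
           + 2 * kappa x * (x - y) * ((x' - y') - (x - y))
         = 2 * r * (x' - y') - r\<^sup>2 * (W + 36 * (1 - 2 * x) * (x' - x))"
    unfolding d k kd using pos by (simp add: field_simps power2_eq_square)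
  ultimately show ?thesis by linarith
qed

section \<open>Gradient and divergence on a connected graph\<close>

text \<open>Edges are not pairs of vertices, so loops and parallel edges are allowed. Paths must
  respect directions, which on a torus is no loss because one can go round.\<close>

locale network =
  fixes V :: "'v set" and E :: "'e set" and src tgt :: "'e \<Rightarrow> 'v" and w :: "'e \<Rightarrow> real"
  assumes finite_V: "finite V" and finite_E: "finite E" and V_nonempty: "V \<noteq> {}"
    and src_in: "e \<in> E \<Longrightarrow> src e \<in> V" and tgt_in: "e \<in> E \<Longrightarrow> tgt e \<in> V"
    and w_pos: "e \<in> E \<Longrightarrow> w e > 0"
    and connected: "p \<in> V \<Longrightarrow> q \<in> V \<Longrightarrow> (p, q) \<in> ((\<lambda>e. (src e, tgt e)) ` E)\<^sup>*"
begin

definition grad :: "('v \<Rightarrow> real) \<Rightarrow> 'e \<Rightarrow> real" where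
  "grad u e = w e * (u (tgt e) - u (src e))"

text \<open>This is minus the adjoint of \<open>grad\<close>, so \<open>dvg (grad u)\<close> is the
  negative semidefinite graph Laplacian with edge weights \<open>(w e)\<^sup>2\<close>.\<close>

definition dvg :: "('e \<Rightarrow> real) \<Rightarrow> 'v \<Rightarrow> real" where
  "dvg X v = (\<Sum>e | e \<in> E \<and> src e = v. w e * X e) - (\<Sum>e | e \<in> E \<and> tgt e = v. w e * X e)"

lemma sum_src:
  "(\<Sum>v\<in>V. (\<Sum>e | e \<in> E \<and> src e = v. X e) * d v) = (\<Sum>e\<in>E. X e * (d (src e) :: real))"
  using sum.group [OF finite_E finite_V, of src "\<lambda>e. X e * d (src e)"] src_in
  by (auto simp: sum_distrib_right image_subset_iff intro!: sum.cong)

lemma sum_tgt: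
  "(\<Sum>v\<in>V. (\<Sum>e | e \<in> E \<and> tgt e = v. X e) * d v) = (\<Sum>e\<in>E. X e * (d (tgt e) :: real))"
  using sum.group [OF finite_E finite_V, of tgt "\<lambda>e. X e * d (tgt e)"] tgt_in
  by (auto simp: sum_distrib_right image_subset_iff intro!: sum.cong)

text \<open>Summation by parts; a graph has no boundary, so no further terms arise. A constant
  \<open>d\<close> yields conservation of mass.\<close>

lemma sum_dvg: "(\<Sum>v\<in>V. dvg X v * d v) = - (\<Sum>e\<in>E. X e * grad d e)"
proof -
  have "(\<Sum>v\<in>V. dvg X v * d v) = (\<Sum>e\<in>E. w e * X e * d (src e)) - (\<Sum>e\<in>E. w e * X e * d (tgt e))"
    by (simp add: dvg_def left_diff_distrib sum_subtractf sum_src sum_tgt)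
  also have "\<dots> = - (\<Sum>e\<in>E. X e * grad d e)"
    by (simp add: grad_def algebra_simps flip: sum_subtractf sum_negf)
  finally show ?thesis .
qed

lemma sum_dvg_eq_0: "(\<Sum>v\<in>V. dvg X v) = 0"
  using sum_dvg [of X "\<lambda>_. 1"] by (simp add: grad_def)

lemma dvg_cong: "(\<And>e. e \<in> E \<Longrightarrow> X e = Y e) \<Longrightarrow> dvg X v = dvg Y v"
  by (simp add: dvg_def)

lemma dvg_add: "dvg (\<lambda>e. X e + Y e) v = dvg X v + dvg Y v"
  by (simp add: dvg_def distrib_left sum.distrib)

lemma dvg_diff: "dvg (\<lambda>e. X e - Y e) v = dvg X v - dvg Y v"
  by (simp add: dvg_def right_diff_distrib sum_subtractf)

lemma dvg_scale: "dvg (\<lambda>e. t * X e) v = t * dvg X v"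
  by (simp add: dvg_def right_diff_distrib sum_distrib_left mult_ac)

lemma grad_diff: "grad (\<lambda>v. a v - b v) e = grad a e - grad b e"
  by (simp add: grad_def algebra_simps)

lemma grad_add_scale: "grad (\<lambda>v. a v + t * b v) e = grad a e + t * grad b e"
  by (simp add: grad_def algebra_simps)

lemma grad_cong:
  "(\<And>v. v \<in> V \<Longrightarrow> u v = u' v) \<Longrightarrow> e \<in> E \<Longrightarrow> grad u e = grad u' e"
  using src_in tgt_in by (simp add: grad_def)

text \<open>Dividing by \<open>w e\<close> cancels the weight inside \<open>dvg\<close>: the flux
  moves one unit of mass from \<open>tgt e\<close> to \<open>src e\<close>.\<close>

lemma dvg_edge:
  assumes "e \<in> E"
  shows "dvg (\<lambda>x. if x = e then 1 / w e else 0) v = of_bool (v = src e) - of_bool (v = tgt e)"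
proof -
  have eq: "(\<Sum>x | x \<in> E \<and> P x. w x * (if x = e then 1 / w e else 0)) = of_bool (P e)" for P
  proof -
    have "(\<Sum>x | x \<in> E \<and> P x. w x * (if x = e then 1 / w e else 0))
          = (\<Sum>x | x \<in> E \<and> P x. if x = e then 1 else 0)"
      using w_pos [OF assms] by (intro sum.cong) auto
    also have "\<dots> = of_bool (P e)"
      using assms finite_E by (simp add: sum.delta')
    finally show ?thesis .
  qed
  show ?thesis
    unfolding dvg_def eq [of "\<lambda>x. src x = v"] eq [of "\<lambda>x. tgt x = v"] by auto
qed

text \<open>Unit fluxes along a path telescope. The result moves mass from \<open>q\<close> to
  \<open>p\<close> and is the test direction when a vertex constraint is active.\<close>

lemma transport_flux:
  assumes "p \<in> V" "q \<in> V"
  shows "\<exists>g. \<forall>v. dvg g v = of_bool (v = p) - of_bool (v = q)"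
  using connected [OF assms]
proof (induction rule: rtrancl_induct)
  case base
  have "\<forall>v. dvg (\<lambda>_. 0) v = of_bool (v = p) - of_bool (v = p)" by (simp add: dvg_def)
  then show ?case by blast
next
  case (step y z)
  then obtain g e where g: "\<forall>v. dvg g v = of_bool (v = p) - of_bool (v = y)"
    and e: "e \<in> E" "y = src e" "z = tgt e" by auto
  have "\<forall>v. dvg (\<lambda>x. g x + (if x = e then 1 / w e else 0)) v = of_bool (v = p) - of_bool (v = z)"
    using g e by (simp add: dvg_add dvg_edge)
  then show ?case by blast
qed

section \<open>Variation of the interfacial energy\<close>

definition energy_grad :: "('v \<Rightarrow> real) \<Rightarrow> 'v \<Rightarrow> real" where
  "energy_grad u v =
     kappa_der (u v) * (((\<Sum>e | e \<in> E \<and> src e = v. (grad u e)\<^sup>2)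
                        + (\<Sum>e | e \<in> E \<and> tgt e = v. (grad u e)\<^sup>2)) / 2)
     - 2 * dvg (\<lambda>e. (kappa (u (src e)) + kappa (u (tgt e))) / 2 * grad u e) v"

lemma energy_grad_cong:
  assumes "\<And>v. v \<in> V \<Longrightarrow> u v = u' v" "v \<in> V"
  shows "energy_grad u v = energy_grad u' v"
  unfolding energy_grad_def
  using assms grad_cong [of u u'] src_in tgt_in
  by (intro arg_cong2 [where f = "(-)"] arg_cong2 [where f = "(*)"] arg_cong2 [where f = "(/)"]
      arg_cong2 [where f = "(+)"] sum.cong dvg_cong refl) auto

text \<open>The right-hand side is the derivative of the edge sum in \<open>energy\<close> in
  direction \<open>d\<close>, so \<open>energy_grad\<close> is its gradient. Regrouping by edges
  gives the \<open>kappa_der\<close> part, summation by parts the rest.\<close>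

lemma sum_energy_grad:
  "(\<Sum>v\<in>V. energy_grad u v * d v) =
   (\<Sum>e\<in>E. (kappa_der (u (src e)) * d (src e) + kappa_der (u (tgt e)) * d (tgt e)) / 2 * (grad u e)\<^sup>2
           + (kappa (u (src e)) + kappa (u (tgt e))) * grad u e * grad d e)"
proof -
  have "(\<Sum>v\<in>V. energy_grad u v * d v) =
      ((\<Sum>v\<in>V. (\<Sum>e | e \<in> E \<and> src e = v. (grad u e)\<^sup>2) * (kappa_der (u v) * d v / 2))
       + (\<Sum>v\<in>V. (\<Sum>e | e \<in> E \<and> tgt e = v. (grad u e)\<^sup>2) * (kappa_der (u v) * d v / 2)))
      - 2 * (\<Sum>v\<in>V. dvg (\<lambda>e. (kappa (u (src e)) + kappa (u (tgt e))) / 2 * grad u e) v * d v)"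
    unfolding sum.distrib [symmetric] sum_distrib_left sum_subtractf [symmetric]
    by (intro sum.cong refl) (simp add: energy_grad_def field_simps)
  then show ?thesis
    unfolding sum_src sum_tgt sum_dvg mult_minus_right diff_minus_eq_add sum_distrib_left
      sum.distrib [symmetric]
    by (simp only:) (intro sum.cong refl, simp add: field_simps)
qed

text \<open>At a minimum of \<open>u\<close> all outgoing gradients are nonnegative and all incoming ones
  nonpositive, so the divergence term has a sign.\<close>

lemma energy_grad_min:
  assumes p: "p \<in> V" and min: "\<And>v. v \<in> V \<Longrightarrow> u p \<le> u v"
    and u: "\<And>v. v \<in> V \<Longrightarrow> 0 < u v \<and> u v < 1"
  shows "energy_grad u p \<le>
    kappa_der (u p) * (((\<Sum>e | e \<in> E \<and> src e = p. (grad u e)\<^sup>2)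
                        + (\<Sum>e | e \<in> E \<and> tgt e = p. (grad u e)\<^sup>2)) / 2)"
proof -
  have k: "kappa (u (src e)) + kappa (u (tgt e)) \<ge> 0" if "e \<in> E" for e
    using kappa_pos u src_in [OF that] tgt_in [OF that] by (smt (verit))
  have "(\<Sum>e | e \<in> E \<and> src e = p. w e * ((kappa (u (src e)) + kappa (u (tgt e))) / 2 * grad u e)) \<ge> 0"
    unfolding grad_def
    by (intro sum_nonneg) (use k w_pos min src_in tgt_in in \<open>auto intro!: mult_nonneg_nonneg simp: less_imp_le\<close>)
  moreover have "(\<Sum>e | e \<in> E \<and> tgt e = p. w e * ((kappa (u (src e)) + kappa (u (tgt e))) / 2 * grad u e)) \<le> 0"
    unfolding grad_def
    by (intro sum_nonpos) (use k w_pos min src_in tgt_in in \<open>auto intro!: mult_nonneg_nonpos simp: less_imp_le\<close>)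
  moreover have "a - 2 * (b - c) \<le> a" if "b \<ge> 0" "c \<le> 0" for a b c :: real
    using that by simp
  ultimately show ?thesis unfolding energy_grad_def dvg_def by blast
qed

lemma energy_grad_max:
  assumes p: "p \<in> V" and max: "\<And>v. v \<in> V \<Longrightarrow> u v \<le> u p"
    and u: "\<And>v. v \<in> V \<Longrightarrow> 0 < u v \<and> u v < 1"
  shows "energy_grad u p \<ge>
    kappa_der (u p) * (((\<Sum>e | e \<in> E \<and> src e = p. (grad u e)\<^sup>2)
                        + (\<Sum>e | e \<in> E \<and> tgt e = p. (grad u e)\<^sup>2)) / 2)"
proof -
  have k: "kappa (u (src e)) + kappa (u (tgt e)) \<ge> 0" if "e \<in> E" for e
    using kappa_pos u src_in [OF that] tgt_in [OF that] by (smt (verit))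
  have "(\<Sum>e | e \<in> E \<and> src e = p. w e * ((kappa (u (src e)) + kappa (u (tgt e))) / 2 * grad u e)) \<le> 0"
    unfolding grad_def
    by (intro sum_nonpos) (use k w_pos max src_in tgt_in in \<open>auto intro!: mult_nonneg_nonpos simp: less_imp_le\<close>)
  moreover have "(\<Sum>e | e \<in> E \<and> tgt e = p. w e * ((kappa (u (src e)) + kappa (u (tgt e))) / 2 * grad u e)) \<ge> 0"
    unfolding grad_def
    by (intro sum_nonneg) (use k w_pos max src_in tgt_in in \<open>auto intro!: mult_nonneg_nonneg simp: less_imp_le\<close>)
  moreover have "a - 2 * (b - c) \<ge> a" if "b \<le> 0" "c \<ge> 0" for a b c :: real
    using that by simp
  ultimately show ?thesis unfolding energy_grad_def dvg_def by blast
qed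

text \<open>Values in the unit interval differ by at most 1. The bound does not depend on
  \<open>u\<close>, so it can enter a constant chosen before the boundary layer.\<close>

lemma incident_grad_bound:
  assumes u: "\<And>v. v \<in> V \<Longrightarrow> 0 < u v \<and> u v < 1"
  shows "((\<Sum>e | e \<in> E \<and> src e = p. (grad u e)\<^sup>2) + (\<Sum>e | e \<in> E \<and> tgt e = p. (grad u e)\<^sup>2)) / 2
          \<le> (\<Sum>e\<in>E. (w e)\<^sup>2)"
proof -
  have le: "(grad u e)\<^sup>2 \<le> (w e)\<^sup>2" if "e \<in> E" for e
  proof -
    have "\<bar>u (tgt e) - u (src e)\<bar> \<le> 1"
      using u [OF src_in [OF that]] u [OF tgt_in [OF that]] by linarith
    then have "\<bar>grad u e\<bar> \<le> \<bar>w e\<bar>"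
      unfolding grad_def abs_mult by (intro mult_left_le) auto
    then show ?thesis by (simp add: abs_le_square_iff)
  qed
  have "(\<Sum>e | e \<in> E \<and> P e. (grad u e)\<^sup>2) \<le> (\<Sum>e\<in>E. (w e)\<^sup>2)" for P
    by (rule order_trans [OF sum_mono sum_mono2]) (use le finite_E in auto)
  from this [of "\<lambda>e. src e = p"] this [of "\<lambda>e. tgt e = p"] show ?thesis by simp
qed

end

section \<open>Implicit steps on a connected graph\<close>

text \<open>\<open>f\<close> is the monotone implicit part with primitive \<open>F\<close>, and
  \<open>c\<close> the part frozen at the old time level. \<open>b \<le> 1\<close> keeps admissible
  values where \<open>kappa\<close> is positive and convex.\<close>

locale convex_splitting = network V E src tgt w
  for V :: "'v set" and E :: "'e set" and src tgt w +
  fixes b :: real and F f :: "real \<Rightarrow> real" and c :: "'v \<Rightarrow> real"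
  assumes b_pos: "0 < b" and b_le: "b \<le> 1"
    and F_deriv: "0 < x \<Longrightarrow> x < b \<Longrightarrow> (F has_real_derivative f x) (at x)"
    and f_mono: "0 < x \<Longrightarrow> x < y \<Longrightarrow> y < b \<Longrightarrow> f x < f y"
    and f_0: "filterlim f at_bot (at_right 0)"
    and f_b: "filterlim f at_top (at_left b)"
begin

definition potential :: "('v \<Rightarrow> real) \<Rightarrow> 'v \<Rightarrow> real" where
  "potential u v = f (u v) + energy_grad u v + c v"

lemma potential_cong:
  "(\<And>v. v \<in> V \<Longrightarrow> u v = u' v) \<Longrightarrow> v \<in> V \<Longrightarrow> potential u v = potential u' v"
  using energy_grad_cong [of u u' v] by (simp add: potential_def)

definition energy :: "('v \<Rightarrow> real) \<Rightarrow> real" where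
  "energy u = (\<Sum>v\<in>V. F (u v) + c v * u v)
     + (\<Sum>e\<in>E. (kappa (u (src e)) + kappa (u (tgt e))) / 2 * (grad u e)\<^sup>2)"

definition admissible :: "('v \<Rightarrow> real) \<Rightarrow> bool" where
  "admissible u \<longleftrightarrow> (\<forall>v\<in>V. 0 < u v \<and> u v < b)"

lemma admissible_unit: "admissible u \<Longrightarrow> v \<in> V \<Longrightarrow> 0 < u v \<and> u v < 1"
  using b_le by (force simp: admissible_def)

section \<open>Monotonicity and uniqueness\<close>

lemma f_mono_le: "0 < x \<Longrightarrow> x \<le> y \<Longrightarrow> y < b \<Longrightarrow> f x \<le> f y"
  using f_mono [of x y] by (cases "x = y") auto

lemma f_mult_nonneg:
  assumes "0 < x" "x < b" "0 < y" "y < b"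
  shows "0 \<le> (f x - f y) * (x - y)" "(f x - f y) * (x - y) \<le> 0 \<Longrightarrow> x = y"
proof -
  have "0 < (f x - f y) * (x - y)" if "x \<noteq> y"
    using that f_mono [of x y] f_mono [of y x] assms
    by (cases "x < y") (auto intro: mult_pos_pos mult_neg_neg)
  then show "0 \<le> (f x - f y) * (x - y)" "(f x - f y) * (x - y) \<le> 0 \<Longrightarrow> x = y"
    by (cases "x = y"; force)+
qed

text \<open>The gradient of a convex function is monotone: adding the tangent inequalities at
  \<open>u\<close> and \<open>u'\<close> cancels the function values. \<open>T\<close> is the
  derivative of the edge energy \<open>Q\<close>.\<close>

lemma energy_grad_monotone:
  assumes "admissible u" "admissible u'"
  shows "0 \<le> (\<Sum>v\<in>V. (energy_grad u v - energy_grad u' v) * (u v - u' v))"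
proof -
  define T where "T = (\<lambda>u d e. (kappa_der (u (src e)) * d (src e) + kappa_der (u (tgt e)) * d (tgt e)) / 2
                               * (grad u e)\<^sup>2
           + (kappa (u (src e)) + kappa (u (tgt e))) * grad u e * grad d e)"
  define Q where "Q = (\<lambda>u e. (kappa (u (src e)) + kappa (u (tgt e))) / 2 * (grad u e)\<^sup>2)"
  \<comment> \<open>The averaged \<open>kappa\<close> splits \<open>Q\<close> into one term per end
    of the edge, and \<open>kappa_edge_convex\<close> applies to each.\<close>
  have T: "Q u e + T u (\<lambda>v. u' v - u v) e \<le> Q u' e"
    if e: "e \<in> E" and u: "admissible u" "admissible u'" for u u' e
  proof -
    define x y x' y' where "x = u (src e)" and "y = u (tgt e)" and "x' = u' (src e)" and "y' = u' (tgt e)"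
    have xy: "0 < x" "x < 1" "0 < y" "y < 1" "0 < x'" "x' < 1" "0 < y'" "y' < 1"
      unfolding x_def y_def x'_def y'_def
      using admissible_unit u src_in [OF e] tgt_in [OF e] by blast+
    define A where "A = kappa x * (x - y)\<^sup>2 + kappa_der x * (x - y)\<^sup>2 * (x' - x)
           + 2 * kappa x * (x - y) * ((x' - y') - (x - y))"
    define B where "B = kappa y * (y - x)\<^sup>2 + kappa_der y * (y - x)\<^sup>2 * (y' - y)
           + 2 * kappa y * (y - x) * ((y' - x') - (y - x))"
    have "A \<le> kappa x' * (x' - y')\<^sup>2" "B \<le> kappa y' * (y' - x')\<^sup>2"
      unfolding A_def B_def using xy by (auto intro: kappa_edge_convex)
    then have "(w e)\<^sup>2 / 2 * (A + B) \<le> (w e)\<^sup>2 / 2 * (kappa x' * (x' - y')\<^sup>2 + kappa y' * (y' - x')\<^sup>2)"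
      by (intro mult_left_mono add_mono) auto
    also have "\<dots> = Q u' e"
      by (simp add: Q_def grad_def x'_def y'_def power2_eq_square field_simps)
    finally show ?thesis
      by (simp add: A_def B_def Q_def T_def grad_def x_def y_def x'_def y'_def power2_eq_square field_simps)
  qed
  have "0 \<le> - T u (\<lambda>v. u' v - u v) e - T u' (\<lambda>v. u v - u' v) e" if "e \<in> E" for e
    using T [OF that assms] T [OF that assms(2,1)] by linarith
  moreover have "T u (\<lambda>v. u' v - u v) e = - T u (\<lambda>v. u v - u' v) e" for e
    by (simp add: T_def grad_def field_simps)
  ultimately have "0 \<le> T u (\<lambda>v. u v - u' v) e - T u' (\<lambda>v. u v - u' v) e" if "e \<in> E" for e
    using that by (metis minus_minus)
  then have "0 \<le> (\<Sum>e\<in>E. T u (\<lambda>v. u v - u' v) e - T u' (\<lambda>v. u v - u' v) e)"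
    by (rule sum_nonneg)
  also have "\<dots> = (\<Sum>v\<in>V. energy_grad u v * (u v - u' v)) - (\<Sum>v\<in>V. energy_grad u' v * (u v - u' v))"
    unfolding sum_energy_grad T_def by (simp add: sum_subtractf)
  finally show ?thesis by (simp add: left_diff_distrib sum_subtractf)
qed

text \<open>Summation by parts makes the pairing of \<open>\<mu>\<close> with \<open>u - u'\<close>
  equal to \<open>- s\<close> times the squared norm of \<open>grad \<mu>\<close>, while
  monotonicity makes it nonnegative; \<open>c\<close> cancels. Strict monotonicity of
  \<open>f\<close> then forces equality at every vertex.\<close>

theorem solution_unique:
  assumes s: "s > 0" and u: "admissible u" "admissible u'"
    and sol: "\<And>v. v \<in> V \<Longrightarrow> u v - \<phi> v = s * dvg (grad (potential u)) v"
      "\<And>v. v \<in> V \<Longrightarrow> u' v - \<phi> v = s * dvg (grad (potential u')) v"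
    and v: "v \<in> V"
  shows "u v = u' v"
proof -
  define \<mu> where "\<mu> = (\<lambda>v. potential u v - potential u' v)"
  have nonneg: "(f (u v) - f (u' v)) * (u v - u' v) \<ge> 0" if "v \<in> V" for v
    using u that by (auto simp: admissible_def intro!: f_mult_nonneg)
  have "u v - u' v = s * dvg (grad \<mu>) v" if "v \<in> V" for v
    using sol [OF that] unfolding \<mu>_def grad_diff dvg_diff right_diff_distrib by linarith
  then have "(\<Sum>v\<in>V. \<mu> v * (u v - u' v)) = s * (\<Sum>v\<in>V. dvg (grad \<mu>) v * \<mu> v)"
    unfolding sum_distrib_left by (intro sum.cong refl) simp
  also have "\<dots> \<le> 0"
    unfolding sum_dvg using s by (intro mult_nonneg_nonpos) (auto intro: sum_nonneg)
  finally have "(\<Sum>v\<in>V. (f (u v) - f (u' v)) * (u v - u' v))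
      + (\<Sum>v\<in>V. (energy_grad u v - energy_grad u' v) * (u v - u' v)) \<le> 0"
    by (simp add: \<mu>_def potential_def sum.distrib [symmetric] algebra_simps)
  with energy_grad_monotone [OF u] have "(\<Sum>v\<in>V. (f (u v) - f (u' v)) * (u v - u' v)) \<le> 0"
    by linarith
  moreover have "(f (u v) - f (u' v)) * (u v - u' v) \<le> (\<Sum>v\<in>V. (f (u v) - f (u' v)) * (u v - u' v))"
    using finite_V v nonneg by (intro member_le_sum) auto
  ultimately have "(f (u v) - f (u' v)) * (u v - u' v) \<le> 0" by linarith
  then show ?thesis
    using u v by (intro f_mult_nonneg(2)) (auto simp: admissible_def)
qed

section \<open>Existence by minimising over fluxes\<close>

lemma energy_has_derivative:
  assumes u: "admissible u"
  shows "((\<lambda>t. energy (\<lambda>v. u v + t * d v)) has_real_derivative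
            (\<Sum>v\<in>V. potential u v * d v)) (at 0)"
proof -
  have F: "((\<lambda>t. F (u v + t * d v) + c v * (u v + t * d v)) has_real_derivative
             (f (u v) * d v + c v * d v)) (at 0)" if "v \<in> V" for v
  proof -
    have F0: "(F has_real_derivative f (u v)) (at (u v + 0 * d v))"
      using F_deriv [of "u v"] u that by (simp add: admissible_def)
    show ?thesis
      by (rule derivative_eq_intros DERIV_chain2 [where g = "\<lambda>t. u v + t * d v", OF F0] refl)+ simp
  qed
  have k: "((\<lambda>t. kappa (u v + t * d v)) has_real_derivative (kappa_der (u v) * d v)) (at 0)"
    if "v \<in> V" for v
  proof -
    have k0: "(kappa has_real_derivative kappa_der (u v)) (at (u v + 0 * d v))"
      using kappa_has_derivative [of "u v"] admissible_unit [OF u that] by simp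
    show ?thesis
      by (rule derivative_eq_intros DERIV_chain2 [where g = "\<lambda>t. u v + t * d v", OF k0] refl)+ simp
  qed
  have edge: "((\<lambda>t. (kappa (u (src e) + t * d (src e)) + kappa (u (tgt e) + t * d (tgt e))) / 2
                 * (grad u e + t * grad d e)\<^sup>2) has_real_derivative
        (kappa_der (u (src e)) * d (src e) + kappa_der (u (tgt e)) * d (tgt e)) / 2 * (grad u e)\<^sup>2
           + (kappa (u (src e)) + kappa (u (tgt e))) * grad u e * grad d e) (at 0)"
    if "e \<in> E" for e
  proof -
    have "((\<lambda>t. (grad u e + t * grad d e)\<^sup>2) has_real_derivative 2 * grad u e * grad d e) (at 0)"
      by (rule derivative_eq_intros refl)+ simp
    from DERIV_mult [OF DERIV_cdivide [OF DERIV_add [OF k [OF src_in] k [OF tgt_in]], of _ _ 2] this]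
    show ?thesis
      by (rule DERIV_cong) (use that in \<open>simp_all add: algebra_simps\<close>)
  qed
  have "((\<lambda>t. energy (\<lambda>v. u v + t * d v)) has_real_derivative
      (\<Sum>v\<in>V. f (u v) * d v + c v * d v) + (\<Sum>v\<in>V. energy_grad u v * d v)) (at 0)"
    unfolding energy_def grad_add_scale sum_energy_grad
    by (intro DERIV_add DERIV_sum F edge)
  then show ?thesis
    by (simp add: potential_def sum.distrib [symmetric] algebra_simps)
qed

text \<open>Since \<open>f\<close> increases, \<open>F\<close> lies above its tangent at
  \<open>b / 2\<close>, which is bounded below on an interval of length at most 1; the edge sum is
  nonnegative. The bound will control the flux of a minimiser.\<close>

lemma energy_bounded_below: "\<exists>B. \<forall>u. admissible u \<longrightarrow> - B \<le> energy u"
proof -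
  define x0 where "x0 = b / 2"
  have x0: "0 < x0" "x0 < b" using b_pos by (auto simp: x0_def)
  have F: "F x0 - \<bar>f x0\<bar> \<le> F x" if x: "0 < x" "x < b" for x
  proof -
    have bd: "- \<bar>f x0\<bar> \<le> f x0 * (x - x0)"
    proof -
      have "\<bar>f x0 * (x - x0)\<bar> \<le> \<bar>f x0\<bar>"
        unfolding abs_mult using x x0 b_le by (intro mult_left_le) auto
      then show ?thesis by linarith
    qed
    have "f x0 * (x - x0) \<le> F x - F x0"
    proof (cases x x0 rule: linorder_cases)
      case less
      then obtain z where z: "x < z" "z < x0" "F x0 - F x = (x0 - x) * f z"
        using MVT2 [of x x0 F f] F_deriv x x0 by fastforce
      have "f z \<le> f x0" using z x x0 by (intro f_mono_le) auto
      then have "(x0 - x) * f z \<le> (x0 - x) * f x0" using less by (intro mult_left_mono) auto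
      then show ?thesis using z by (simp add: algebra_simps)
    next
      case greater
      then obtain z where z: "x0 < z" "z < x" "F x - F x0 = (x - x0) * f z"
        using MVT2 [of x0 x F f] F_deriv x x0 by fastforce
      have "f x0 \<le> f z" using z x x0 by (intro f_mono_le) auto
      then have "(x - x0) * f x0 \<le> (x - x0) * f z" using greater by (intro mult_left_mono) auto
      then show ?thesis using z by (simp add: algebra_simps)
    qed simp
    with bd show ?thesis by linarith
  qed
  have "(\<Sum>v\<in>V. F x0 - \<bar>f x0\<bar> - \<bar>c v\<bar>) \<le> energy u" if u: "admissible u" for u
  proof -
    have "F x0 - \<bar>f x0\<bar> - \<bar>c v\<bar> \<le> F (u v) + c v * u v" if v: "v \<in> V" for v
    proof -
      have "\<bar>c v * u v\<bar> \<le> \<bar>c v\<bar>"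
        unfolding abs_mult using admissible_unit [OF u v] by (intro mult_left_le) auto
      then show ?thesis using F [of "u v"] u v by (auto simp: admissible_def)
    qed
    then have "(\<Sum>v\<in>V. F x0 - \<bar>f x0\<bar> - \<bar>c v\<bar>) \<le> (\<Sum>v\<in>V. F (u v) + c v * u v)"
      by (rule sum_mono)
    moreover have "0 \<le> (\<Sum>e\<in>E. (kappa (u (src e)) + kappa (u (tgt e))) / 2 * (grad u e)\<^sup>2)"
      by (intro sum_nonneg mult_nonneg_nonneg divide_nonneg_nonneg add_nonneg_nonneg)
         (use admissible_unit [OF u] kappa_pos src_in tgt_in in \<open>auto intro!: less_imp_le\<close>)
    ultimately show ?thesis unfolding energy_def by linarith
  qed
  then show ?thesis by (intro exI [of _ "- (\<Sum>v\<in>V. F x0 - \<bar>f x0\<bar> - \<bar>c v\<bar>)"]) auto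
qed

text \<open>One step of a minimising movement: minimised over all \<open>g\<close> with the same
  divergence, the first term is a squared discrete \<open>H^-1\<close> distance between the time
  levels, divided by \<open>2 * s\<close>.\<close>

definition flux_energy :: "real \<Rightarrow> ('v \<Rightarrow> real) \<Rightarrow> ('e \<Rightarrow> real) \<Rightarrow> real" where
  "flux_energy s \<phi> g = (\<Sum>e\<in>E. (g e)\<^sup>2) / (2 * s) + energy (\<lambda>v. \<phi> v + dvg g v)"

text \<open>\<open>R\<close> provides compactness and \<open>\<delta>\<close> keeps the values away
  from the singularities; for suitable choices both constraints turn out to be inactive at a
  minimiser.\<close>

definition flux_box :: "real \<Rightarrow> real \<Rightarrow> ('v \<Rightarrow> real) \<Rightarrow> ('e \<Rightarrow> real) \<Rightarrow> bool" where
  "flux_box \<delta> R \<phi> g \<longleftrightarrow> (\<forall>e\<in>E. \<bar>g e\<bar> \<le> R) \<and> (\<forall>v\<in>V. \<delta> \<le> \<phi> v + dvg g v \<and> \<phi> v + dvg g v \<le> b - \<delta>)"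

lemma flux_box_admissible: "0 < \<delta> \<Longrightarrow> flux_box \<delta> R \<phi> g \<Longrightarrow> admissible (\<lambda>v. \<phi> v + dvg g v)"
  by (force simp: flux_box_def admissible_def)

lemma flux_energy_cong:
  assumes "\<And>e. e \<in> E \<Longrightarrow> g e = h e"
  shows "flux_energy s \<phi> g = flux_energy s \<phi> h"
  using assms dvg_cong [of g h] by (simp add: flux_energy_def cong: sum.cong)

lemma flux_minimizer_exists:
  assumes \<delta>: "\<delta> > 0" and R: "R \<ge> 0" and \<phi>: "\<And>v. v \<in> V \<Longrightarrow> \<delta> \<le> \<phi> v \<and> \<phi> v \<le> b - \<delta>"
    and s: "s > 0"
  obtains g where "flux_box \<delta> R \<phi> g" "\<And>h. flux_box \<delta> R \<phi> h \<Longrightarrow> flux_energy s \<phi> g \<le> flux_energy s \<phi> h"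
proof -
  \<comment> \<open>Fluxes are functions on the whole type, so coordinates outside \<open>E\<close>
    are pinned to 0; \<open>P\<close> is then compact by Tychonoff's theorem.\<close>
  define P :: "('e \<Rightarrow> real) set" where "P = (\<Pi>\<^sub>E e\<in>UNIV. if e \<in> E then {- R..R} else {0})"
  define K where "K = P \<inter> (\<Inter>v\<in>V. {g. \<phi> v + dvg g v \<in> {\<delta>..b - \<delta>}})"
  have coord: "continuous_on A (\<lambda>g :: 'e \<Rightarrow> real. g e)" for A e
    by (rule continuous_on_subset [OF continuous_on_product_coordinates]) simp
  have dvg: "continuous_on A (\<lambda>g :: 'e \<Rightarrow> real. \<phi> v + dvg g v)" for A v
    unfolding dvg_def by (intro continuous_intros coord)
  have "compactin (product_topology (\<lambda>_. euclidean) UNIV) P"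
    unfolding P_def compactin_PiE by auto
  then have "compact P"
    by (simp add: euclidean_product_topology)
  moreover have "closed (\<Inter>v\<in>V. {g. \<phi> v + dvg g v \<in> {\<delta>..b - \<delta>}})"
  proof (intro closed_INT ballI)
    fix v
    have "closed ((\<lambda>g. \<phi> v + dvg g v) -` {\<delta>..b - \<delta>})"
      by (rule closed_vimage [OF closed_atLeastAtMost dvg])
    then show "closed {g. \<phi> v + dvg g v \<in> {\<delta>..b - \<delta>}}" by (simp add: vimage_def)
  qed
  ultimately have "compact K" unfolding K_def by (rule compact_Int_closed)
  moreover have "(\<lambda>_. 0) \<in> K"
    using R \<phi> by (auto simp: K_def P_def dvg_def)
  moreover have "continuous_on K (flux_energy s \<phi>)"
  proof -
    have range: "(\<lambda>g. \<phi> v + dvg g v) ` K \<subseteq> {0<..<b}" if "v \<in> V" for v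
      using that \<delta> by (force simp: K_def)
    have "continuous_on {0<..<b} F"
      by (intro continuous_at_imp_continuous_on ballI DERIV_isCont [OF F_deriv]) auto
    then have F: "continuous_on K (\<lambda>g. F (\<phi> v + dvg g v))" if "v \<in> V" for v
      by (rule continuous_on_compose2) (use dvg range that in auto)
    have "continuous_on {0<..<b} kappa"
      by (intro continuous_at_imp_continuous_on ballI DERIV_isCont [OF kappa_has_derivative])
        (use b_le in auto)
    then have kappa: "continuous_on K (\<lambda>g. kappa (\<phi> v + dvg g v))" if "v \<in> V" for v
      by (rule continuous_on_compose2) (use dvg range that in auto)
    show ?thesis
      unfolding flux_energy_def energy_def grad_def
      by (intro continuous_intros coord dvg F kappa src_in tgt_in) (use s in auto)
  qed
  ultimately obtain g where g: "g \<in> K" "\<And>h. h \<in> K \<Longrightarrow> flux_energy s \<phi> g \<le> flux_energy s \<phi> h"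
    using continuous_attains_inf [of K "flux_energy s \<phi>"] by blast
  show ?thesis
  proof (rule that)
    show "flux_box \<delta> R \<phi> g"
    proof -
      have "\<bar>g e\<bar> \<le> R" if "e \<in> E" for e
      proof -
        have "g e \<in> (if e \<in> E then {- R..R} else {0})"
          using g(1) unfolding K_def P_def by (blast dest: PiE_mem)
        then show ?thesis using that by auto
      qed
      then show ?thesis using g(1) by (auto simp: K_def flux_box_def)
    qed
    fix h assume h: "flux_box \<delta> R \<phi> h"
    define h' where "h' = (\<lambda>e. if e \<in> E then h e else 0)"
    have "dvg h' v = dvg h v" for v by (rule dvg_cong) (simp add: h'_def)
    moreover have "- R \<le> h e" "h e \<le> R" if "e \<in> E" for e
      using h that by (auto simp: flux_box_def abs_le_iff dest!: bspec)
    ultimately have "h' \<in> K"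
      using h by (auto simp: K_def P_def flux_box_def h'_def)
    then show "flux_energy s \<phi> g \<le> flux_energy s \<phi> h"
      using g(2) [of h'] flux_energy_cong [of h h' s \<phi>] by (simp add: h'_def)
  qed
qed

lemma flux_energy_has_derivative:
  fixes g h :: "'e \<Rightarrow> real"
  assumes s: "s > 0" and u: "admissible (\<lambda>v. \<phi> v + dvg g v)"
  shows "((\<lambda>t. flux_energy s \<phi> (\<lambda>e. g e + t * h e)) has_real_derivative
           (\<Sum>e\<in>E. g e * h e) / s + (\<Sum>v\<in>V. potential (\<lambda>v. \<phi> v + dvg g v) v * dvg h v)) (at 0)"
proof -
  have sq: "((\<lambda>t. (g e + t * h e)\<^sup>2) has_real_derivative 2 * (g e * h e)) (at 0)" for e
    by (rule derivative_eq_intros refl)+ simp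
  have "((\<lambda>t. (\<Sum>e\<in>E. (g e + t * h e)\<^sup>2) / (2 * s)) has_real_derivative
          (\<Sum>e\<in>E. 2 * (g e * h e)) / (2 * s)) (at 0)"
    by (intro DERIV_cdivide DERIV_sum sq)
  from DERIV_add [OF this energy_has_derivative [OF u, of "dvg h"]] s show ?thesis
    by (simp add: flux_energy_def dvg_add dvg_scale add.assoc flip: sum_distrib_left)
qed

text \<open>A negative derivative would lower the energy for small \<open>t > 0\<close> without
  leaving the box. Variations are one-sided, so a vertex constraint may be active, while the strict
  bound by \<open>R\<close> survives small changes.\<close>

lemma flux_first_order:
  assumes s: "s > 0" and \<delta>: "\<delta> > 0" and g: "flux_box \<delta> R \<phi> g"
    and min: "\<And>h. flux_box \<delta> R \<phi> h \<Longrightarrow> flux_energy s \<phi> g \<le> flux_energy s \<phi> h"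
    and R: "\<And>e. e \<in> E \<Longrightarrow> \<bar>g e\<bar> < R"
    and V: "\<And>v. v \<in> V \<Longrightarrow> \<forall>\<^sub>F t in at_right 0.
          \<delta> \<le> \<phi> v + dvg g v + t * dvg h v \<and> \<phi> v + dvg g v + t * dvg h v \<le> b - \<delta>"
  shows "0 \<le> (\<Sum>e\<in>E. g e * h e) / s + (\<Sum>v\<in>V. potential (\<lambda>v. \<phi> v + dvg g v) v * dvg h v)"
    (is "0 \<le> ?D")
proof (rule ccontr)
  assume "\<not> 0 \<le> ?D"
  then obtain d where d: "d > 0"
    "\<And>t. 0 < t \<Longrightarrow> t < d \<Longrightarrow> flux_energy s \<phi> (\<lambda>e. g e + t * h e) < flux_energy s \<phi> g"
    using DERIV_neg_dec_right [OF flux_energy_has_derivative [OF s flux_box_admissible [OF \<delta> g], of h]]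
    by auto
  have dec: "\<forall>\<^sub>F t in at_right 0. flux_energy s \<phi> (\<lambda>e. g e + t * h e) < flux_energy s \<phi> g"
    using d by (auto simp: eventually_at_right_field)
  have "\<forall>\<^sub>F t in at_right 0. \<bar>g e + t * h e\<bar> \<le> R" if "e \<in> E" for e
  proof -
    have "((\<lambda>t. \<bar>g e + t * h e\<bar>) \<longlongrightarrow> \<bar>g e + 0 * h e\<bar>) (at_right 0)"
      by (intro tendsto_intros)
    then have "\<forall>\<^sub>F t in at_right 0. \<bar>g e + t * h e\<bar> < R"
      by (rule order_tendstoD) (use R that in simp)
    then show ?thesis by (rule eventually_mono) simp
  qed
  then have "\<forall>\<^sub>F t in at_right 0. flux_box \<delta> R \<phi> (\<lambda>e. g e + t * h e)"
    unfolding flux_box_def dvg_add dvg_scale add.assoc [symmetric]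
    by (intro eventually_conj eventually_ball_finite finite_E finite_V ballI V)
  with dec have "\<forall>\<^sub>F t in at_right (0::real). False"
    by eventually_elim (use min in force)
  then show False by simp
qed

lemma boundary_layer:
  assumes "admissible \<phi>"
  obtains \<delta> where "\<delta> > 0" "\<And>v. v \<in> V \<Longrightarrow> \<delta> \<le> \<phi> v \<and> \<phi> v \<le> b - \<delta>"
    "\<And>x. 0 < x \<Longrightarrow> x \<le> \<delta> \<Longrightarrow> f x < - Z" "\<And>x. b - \<delta> \<le> x \<Longrightarrow> x < b \<Longrightarrow> Z < f x"
proof -
  obtain a0 where a0: "a0 > 0" "\<And>x. 0 < x \<Longrightarrow> x < a0 \<Longrightarrow> f x < - Z"
    using f_0 unfolding filterlim_at_bot_dense eventually_at_right_field by blast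
  obtain a1 where a1: "a1 < b" "\<And>x. a1 < x \<Longrightarrow> x < b \<Longrightarrow> Z < f x"
    using f_b unfolding filterlim_at_top_dense eventually_at_left_field by blast
  define A where "A = insert (a0 / 2) (insert ((b - a1) / 2) (\<phi> ` V \<union> (\<lambda>v. b - \<phi> v) ` V))"
  have A: "finite A" "A \<noteq> {}" "\<And>x. x \<in> A \<Longrightarrow> 0 < x"
    using finite_V a0 a1 assms by (auto simp: A_def admissible_def)
  define \<delta> where "\<delta> = Min A"
  have le: "\<delta> \<le> x" if "x \<in> A" for x using A that by (simp add: \<delta>_def)
  show ?thesis
  proof
    show "\<delta> > 0" using A Min_in [of A] by (simp add: \<delta>_def)
    show "\<delta> \<le> \<phi> v \<and> \<phi> v \<le> b - \<delta>" if "v \<in> V" for v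
      using le [of "\<phi> v"] le [of "b - \<phi> v"] that by (auto simp: A_def)
    have le': "\<delta> \<le> a0 / 2" "\<delta> \<le> (b - a1) / 2"
      by (rule le, simp add: A_def)+
    show "f x < - Z" if "0 < x" "x \<le> \<delta>" for x
      using that a0(1) le' by (intro a0(2)) auto
    show "Z < f x" if "b - \<delta> \<le> x" "x < b" for x
      using that a1(1) le' by (intro a1(2)) auto
  qed
qed

text \<open>If the sum of \<open>u\<close> is fixed, its extreme values lie on the two sides of the mean value
  \<open>x0\<close>. Then the interfacial energy contributes only a bounded amount to the difference of the
  potential between the two extreme points, while \<open>f\<close> is unbounded at the ends.\<close>

lemma potential_extremes:
  assumes u: "admissible u" and p: "p \<in> V" "\<And>v. v \<in> V \<Longrightarrow> u p \<le> u v"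
    and q: "q \<in> V" "\<And>v. v \<in> V \<Longrightarrow> u v \<le> u q"
    and x0: "u p \<le> x0" "x0 \<le> u q" "x0 < 1"
  shows "potential u p - potential u q
         \<le> f (u p) - f (u q) + 2 * (\<bar>kappa_der x0\<bar> * (\<Sum>e\<in>E. (w e)\<^sup>2)) + 2 * (\<Sum>v\<in>V. \<bar>c v\<bar>)"
proof -
  define G where "G = (\<lambda>v. ((\<Sum>e | e \<in> E \<and> src e = v. (grad u e)\<^sup>2)
                         + (\<Sum>e | e \<in> E \<and> tgt e = v. (grad u e)\<^sup>2)) / 2)"
  have G: "0 \<le> G v" "G v \<le> (\<Sum>e\<in>E. (w e)\<^sup>2)" for v
    unfolding G_def using incident_grad_bound [of u v] admissible_unit [OF u]
    by (auto intro!: add_nonneg_nonneg sum_nonneg)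
  have kG: "\<bar>kappa_der x0\<bar> * G v \<le> \<bar>kappa_der x0\<bar> * (\<Sum>e\<in>E. (w e)\<^sup>2)" for v
    using G by (intro mult_left_mono) auto
  have up: "0 < u p" "u q < 1" using admissible_unit [OF u] p q by auto
  have "energy_grad u p \<le> kappa_der (u p) * G p"
    unfolding G_def using admissible_unit [OF u] p by (intro energy_grad_min) auto
  also have "\<dots> \<le> \<bar>kappa_der x0\<bar> * G p"
    using kappa_der_mono [of "u p" x0] up x0 G by (intro mult_right_mono) auto
  finally have 1: "energy_grad u p \<le> \<bar>kappa_der x0\<bar> * (\<Sum>e\<in>E. (w e)\<^sup>2)" using kG [of p] by linarith
  have "- \<bar>kappa_der x0\<bar> * G q \<le> kappa_der (u q) * G q"
    using kappa_der_mono [of x0 "u q"] up x0 G by (intro mult_right_mono) auto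
  also have "\<dots> \<le> energy_grad u q"
    unfolding G_def using admissible_unit [OF u] q by (intro energy_grad_max) auto
  finally have 2: "- (\<bar>kappa_der x0\<bar> * (\<Sum>e\<in>E. (w e)\<^sup>2)) \<le> energy_grad u q" using kG [of q] by simp
  have "\<bar>c v\<bar> \<le> (\<Sum>v\<in>V. \<bar>c v\<bar>)" if "v \<in> V" for v
    using that finite_V by (intro member_le_sum) auto
  from this [OF p(1)] this [OF q(1)] 1 2 show ?thesis
    unfolding potential_def by linarith
qed

text \<open>The constants are chosen in the order \<open>R\<close>, \<open>C\<close>,
  \<open>\<delta>\<close>, and only then is the minimiser taken; hence the bounds that define them
  must not depend on it.\<close>

theorem solution_exists:
  assumes s: "s > 0" and \<phi>: "admissible \<phi>"
  shows "\<exists>u. admissible u \<and> (\<forall>v\<in>V. u v - \<phi> v = s * dvg (grad (potential u)) v)"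
proof -
  obtain gf where gf: "\<And>p q v. p \<in> V \<Longrightarrow> q \<in> V \<Longrightarrow> dvg (gf p q) v = of_bool (v = p) - of_bool (v = q)"
    using transport_flux by metis
  obtain B where B: "\<And>u. admissible u \<Longrightarrow> - B \<le> energy u"
    using energy_bounded_below by blast
  \<comment> \<open>Comparison with the zero flux bounds each \<open>(g e)\<^sup>2\<close> of a
    minimiser by \<open>2 * s * (energy \<phi> + B)\<close>; the added 1 makes the bound by
    \<open>R\<close> strict.\<close>
  define R where "R = 1 + \<bar>2 * s * (energy \<phi> + B)\<bar>"
  have R: "R \<ge> 0" "2 * s * (energy \<phi> + B) < R\<^sup>2"
  proof -
    have "R * 1 \<le> R * R" by (intro mult_left_mono) (auto simp: R_def)
    then show "2 * s * (energy \<phi> + B) < R\<^sup>2" by (simp add: R_def power2_eq_square)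
  qed (simp add: R_def)
  \<comment> \<open>The mean is conserved because divergences sum to zero, so it lies between the
    extreme values of every candidate.\<close>
  define x0 where "x0 = (\<Sum>v\<in>V. \<phi> v) / card V"
  have card: "card V > 0" using finite_V V_nonempty by (simp add: card_gt_0_iff)
  have x0: "0 < x0" "x0 < b"
  proof -
    have "0 < (\<Sum>v\<in>V. \<phi> v)"
      using finite_V V_nonempty \<phi> by (intro sum_pos) (auto simp: admissible_def)
    moreover have "(\<Sum>v\<in>V. \<phi> v) < (\<Sum>v\<in>V. b)"
      using finite_V V_nonempty \<phi> by (intro sum_strict_mono) (auto simp: admissible_def)
    ultimately show "0 < x0" "x0 < b" using card by (auto simp: x0_def field_simps)
  qed
  \<comment> \<open>Bounds all terms except \<open>f\<close> in the derivative along a transport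
    flux. The extreme points are not yet known, hence the sum over all \<open>p\<close> and
    \<open>q\<close>.\<close>
  define C where "C = 2 * (\<bar>kappa_der x0\<bar> * (\<Sum>e\<in>E. (w e)\<^sup>2)) + 2 * (\<Sum>v\<in>V. \<bar>c v\<bar>)
                      + (\<Sum>p\<in>V. \<Sum>q\<in>V. \<Sum>e\<in>E. R * \<bar>gf p q e\<bar>) / s"
  have C: "C \<ge> 0"
    unfolding C_def using s R by (auto intro!: add_nonneg_nonneg mult_nonneg_nonneg sum_nonneg divide_nonneg_nonneg)
  obtain \<delta> where \<delta>: "\<delta> > 0" "\<And>v. v \<in> V \<Longrightarrow> \<delta> \<le> \<phi> v \<and> \<phi> v \<le> b - \<delta>"
    and f\<delta>: "\<And>x. 0 < x \<Longrightarrow> x \<le> \<delta> \<Longrightarrow> f x < - (C + \<bar>f x0\<bar>)"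
      "\<And>x. b - \<delta> \<le> x \<Longrightarrow> x < b \<Longrightarrow> C + \<bar>f x0\<bar> < f x"
    using boundary_layer [OF \<phi>, of "C + \<bar>f x0\<bar>"] by metis
  obtain g where g: "flux_box \<delta> R \<phi> g"
    and min: "\<And>h. flux_box \<delta> R \<phi> h \<Longrightarrow> flux_energy s \<phi> g \<le> flux_energy s \<phi> h"
    using flux_minimizer_exists [where \<phi> = \<phi> and R = R and \<delta> = \<delta>, OF \<delta>(1) R(1) \<delta>(2) s] by blast
  define u where "u = (\<lambda>v. \<phi> v + dvg g v)"
  have u: "admissible u" unfolding u_def using \<delta>(1) g by (rule flux_box_admissible)
  have box: "\<delta> \<le> u v" "u v \<le> b - \<delta>" if "v \<in> V" for v
    using g that by (auto simp: flux_box_def u_def)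
  have gR: "\<bar>g e\<bar> < R" if e: "e \<in> E" for e
  proof -
    have "flux_energy s \<phi> g \<le> flux_energy s \<phi> (\<lambda>_. 0)"
      using \<delta> R by (intro min) (auto simp: flux_box_def dvg_def)
    then have "(\<Sum>e\<in>E. (g e)\<^sup>2) / (2 * s) + energy u \<le> energy \<phi>"
      by (simp add: flux_energy_def dvg_def u_def)
    with B [OF u] have "(\<Sum>e\<in>E. (g e)\<^sup>2) / (2 * s) \<le> energy \<phi> + B" by linarith
    then have "(\<Sum>e\<in>E. (g e)\<^sup>2) \<le> 2 * s * (energy \<phi> + B)"
      using s by (simp add: field_simps)
    moreover have "(g e)\<^sup>2 \<le> (\<Sum>e\<in>E. (g e)\<^sup>2)"
      using e finite_E by (intro member_le_sum) auto
    ultimately have "\<bar>g e\<bar>\<^sup>2 < R\<^sup>2" using R by simp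
    then show ?thesis using R(1) by (rule power2_less_imp_less)
  qed
  have first_order: "0 \<le> (\<Sum>e\<in>E. g e * h e) / s + (\<Sum>v\<in>V. potential u v * dvg h v)"
    if "\<And>v. v \<in> V \<Longrightarrow> \<forall>\<^sub>F t in at_right 0. \<delta> \<le> u v + t * dvg h v \<and> u v + t * dvg h v \<le> b - \<delta>" for h
    unfolding u_def
    by (rule flux_first_order [OF s \<delta>(1) g min gR]) (use that in \<open>auto simp: u_def\<close>)

  have interior: "\<delta> < u v \<and> u v < b - \<delta>" if v: "v \<in> V" for v
  proof (rule ccontr)
    assume "\<not> (\<delta> < u v \<and> u v < b - \<delta>)"
    with box [OF v] have bd: "u v = \<delta> \<or> u v = b - \<delta>" by auto
    have fin: "finite (u ` V)" "u ` V \<noteq> {}" using finite_V V_nonempty by auto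
    obtain p where p: "p \<in> V" "\<And>v. v \<in> V \<Longrightarrow> u p \<le> u v"
      using Min_in [OF fin] Min_le [OF fin(1)] by (metis (no_types, lifting) imageE imageI)
    obtain q where q: "q \<in> V" "\<And>v. v \<in> V \<Longrightarrow> u v \<le> u q"
      using Max_in [OF fin] Max_ge [OF fin(1)] by (metis (no_types, lifting) imageE imageI)
    have "(\<Sum>v\<in>V. u v) = card V * x0"
      using card by (simp add: u_def sum.distrib sum_dvg_eq_0 x0_def)
    moreover have "card V * u p \<le> (\<Sum>v\<in>V. u v)" "(\<Sum>v\<in>V. u v) \<le> card V * u q"
      using sum_bounded_below [of V "u p" u] sum_bounded_above [of V u "u q"] p q by auto
    ultimately have mean: "u p \<le> x0" "x0 \<le> u q" using card by auto
    have pq: "0 < u p" "u q < b" using u p q by (auto simp: admissible_def)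
    have le: "f (u p) \<le> f x0" "f x0 \<le> f (u q)"
      using pq mean x0 by (auto intro!: f_mono_le)
    have "u p \<le> \<delta> \<or> b - \<delta> \<le> u q"
      using bd p(2) [OF v] q(2) [OF v] by auto
    \<comment> \<open>One extreme value lies in the boundary layer, the other beyond
      \<open>x0\<close>; the summand \<open>\<bar>f x0\<bar>\<close> in the threshold absorbs the
      value of \<open>f\<close> at the latter.\<close>
    then have less: "f (u p) - f (u q) < - C"
    proof
      assume "u p \<le> \<delta>"
      then show ?thesis using f\<delta>(1) [of "u p"] pq le by linarith
    next
      assume "b - \<delta> \<le> u q"
      then show ?thesis using f\<delta>(2) [of "u q"] pq le by linarith
    qed
    have lt: "u p < u q" using less C p(2) [OF q(1)] by (cases "u p = u q") auto
    define h where "h = gf p q"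
    have h: "dvg h v = of_bool (v = p) - of_bool (v = q)" for v
      unfolding h_def by (rule gf [OF p(1) q(1)])
    have "0 \<le> (\<Sum>e\<in>E. g e * h e) / s + (\<Sum>v\<in>V. potential u v * dvg h v)"
    proof (rule first_order)
      \<comment> \<open>For \<open>t\<close> below \<open>u q - u p\<close> the two changed values
        stay between \<open>u p\<close> and \<open>u q\<close>, hence in the box.\<close>
      fix v assume v: "v \<in> V"
      have "\<forall>\<^sub>F t in at_right 0. 0 < t \<and> t < u q - u p"
        using lt by (auto simp: eventually_at_right_field intro!: exI [of _ "u q - u p"])
      then show "\<forall>\<^sub>F t in at_right 0. \<delta> \<le> u v + t * dvg h v \<and> u v + t * dvg h v \<le> b - \<delta>"
        by (rule eventually_mono) (use box [OF v] box [OF p(1)] box [OF q(1)] lt in \<open>auto simp: h\<close>)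
    qed
    moreover have "(\<Sum>v\<in>V. potential u v * dvg h v) = potential u p - potential u q"
    proof -
      have "(\<Sum>v\<in>V. potential u v * of_bool (v = a)) = potential u a" if "a \<in> V" for a
        using that finite_V by (simp add: of_bool_def if_distrib cong: if_cong)
      then show ?thesis using p(1) q(1) by (simp add: h right_diff_distrib sum_subtractf)
    qed
    moreover have "(\<Sum>e\<in>E. g e * h e) \<le> (\<Sum>p\<in>V. \<Sum>q\<in>V. \<Sum>e\<in>E. R * \<bar>gf p q e\<bar>)"
    proof -
      have "(\<Sum>e\<in>E. g e * h e) \<le> (\<Sum>e\<in>E. R * \<bar>h e\<bar>)"
      proof (rule sum_mono)
        fix e assume e: "e \<in> E"
        have "g e * h e \<le> \<bar>g e\<bar> * \<bar>h e\<bar>" by (simp flip: abs_mult)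
        also have "\<dots> \<le> R * \<bar>h e\<bar>" using gR [OF e] by (intro mult_right_mono) auto
        finally show "g e * h e \<le> R * \<bar>h e\<bar>" .
      qed
      also have "\<dots> \<le> (\<Sum>q\<in>V. \<Sum>e\<in>E. R * \<bar>gf p q e\<bar>)"
        unfolding h_def using q(1) finite_V R
        by (intro member_le_sum [of q V "\<lambda>q. \<Sum>e\<in>E. R * \<bar>gf p q e\<bar>"]) (auto intro: sum_nonneg)
      also have "\<dots> \<le> (\<Sum>p\<in>V. \<Sum>q\<in>V. \<Sum>e\<in>E. R * \<bar>gf p q e\<bar>)"
        using p(1) finite_V R
        by (intro member_le_sum [of p V "\<lambda>p. \<Sum>q\<in>V. \<Sum>e\<in>E. R * \<bar>gf p q e\<bar>"]) (auto intro!: sum_nonneg)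
      finally show ?thesis .
    qed
    then have "(\<Sum>e\<in>E. g e * h e) / s \<le> (\<Sum>p\<in>V. \<Sum>q\<in>V. \<Sum>e\<in>E. R * \<bar>gf p q e\<bar>) / s"
      using s by (intro divide_right_mono) auto
    moreover have "potential u p - potential u q
         \<le> f (u p) - f (u q) + 2 * (\<bar>kappa_der x0\<bar> * (\<Sum>e\<in>E. (w e)\<^sup>2)) + 2 * (\<Sum>v\<in>V. \<bar>c v\<bar>)"
      using u p q mean x0 b_le by (intro potential_extremes) auto
    ultimately show False using less unfolding C_def by linarith
  qed

  \<comment> \<open>No constraint is active any more, so every direction is allowed. Fluxes of size
    1 and -1 on the single edge \<open>e0\<close> turn the inequality into the Euler-Lagrange
    equation.\<close>
  have "g e0 = s * grad (potential u) e0" if e0: "e0 \<in> E" for e0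
  proof -
    have nonneg: "0 \<le> (\<Sum>e\<in>E. g e * h e) / s + (\<Sum>v\<in>V. potential u v * dvg h v)" for h
    proof (rule first_order)
      fix v assume v: "v \<in> V"
      have lim: "((\<lambda>t. u v + t * dvg h v) \<longlongrightarrow> u v + 0 * dvg h v) (at_right 0)"
        by (intro tendsto_intros)
      have "\<forall>\<^sub>F t in at_right 0. \<delta> < u v + t * dvg h v" "\<forall>\<^sub>F t in at_right 0. u v + t * dvg h v < b - \<delta>"
        using order_tendstoD [OF lim] interior [OF v] by auto
      then show "\<forall>\<^sub>F t in at_right 0. \<delta> \<le> u v + t * dvg h v \<and> u v + t * dvg h v \<le> b - \<delta>"
        by eventually_elim auto
    qed
    have eq: "(\<Sum>v\<in>V. potential u v * dvg h v) = - (\<Sum>e\<in>E. h e * grad (potential u) e)" for h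
      using sum_dvg [of h "potential u"] by (simp add: mult.commute)
    have single: "(\<Sum>e\<in>E. (if e = e0 then x else 0) * k e) = x * k e0" for x and k :: "'e \<Rightarrow> real"
      using e0 finite_E by (simp add: if_distrib [of "\<lambda>x. x * _"] cong: if_cong)
    have "0 \<le> g e0 * x / s - x * grad (potential u) e0" for x
    proof -
      have flux: "(\<Sum>e\<in>E. g e * (if e = e0 then x else 0)) = g e0 * x"
        using single [of x g] by (simp only: mult.commute)
      then show ?thesis
        using nonneg [of "\<lambda>e. if e = e0 then x else 0"] unfolding eq single flux by linarith
    qed
    from this [of 1] this [of "-1"] have "g e0 / s = grad (potential u) e0" by simp
    then show ?thesis using s by (simp add: field_simps)
  qed
  then have "dvg g v = s * dvg (grad (potential u)) v" for v
    unfolding dvg_scale [symmetric] by (rule dvg_cong)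
  moreover have "u v - \<phi> v = dvg g v" for v by (simp add: u_def)
  ultimately show ?thesis using u by metis
qed

end

text \<open>The subtracted linear term compensates the constants dropped in \<open>S_der\<close>.
  Near 0 only \<open>ln x\<close> is singular, near \<open>1 / rho M N\<close> only the other
  logarithm, each with the sign required.\<close>

lemma convex_splitting_S:
  assumes "network V E src tgt w" "M > 0" "N > 0"
  shows "convex_splitting V E src tgt w (1 / rho M N)
    (\<lambda>x. S_fun M N x - ((ln (alpha M N / tau M N) + 1) / tau M N
               + (ln (beta M N / tau M N) + 1) / N - rho M N) * x) (S_der M N)"
proof -
  interpret network V E src tgt w by fact
  have t: "tau M N > 0" using assms by (simp add: tau_def)
  define r a where "r = rho M N" and "a = 1 / tau M N + 1 / N"
  have r: "r > 1" and a: "a > 0" using t assms by (auto simp: r_def a_def rho_def intro!: add_pos_pos)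
  have S: "S_der M N x = a * ln x - r * ln (1 - r * x)" for x by (simp add: S_der_def r_def a_def)
  show ?thesis
    unfolding r_def [symmetric]
  proof
    show "0 < 1 / r" "1 / r \<le> 1" using r by auto
    show "((\<lambda>x. S_fun M N x - ((ln (alpha M N / tau M N) + 1) / tau M N
               + (ln (beta M N / tau M N) + 1) / N - r) * x) has_real_derivative S_der M N x) (at x)"
      if "0 < x" "x < 1 / r" for x
      by (rule DERIV_cong [OF DERIV_diff [OF S_fun_has_derivative [OF assms(2,3)] DERIV_cmult_Id]])
         (use that in \<open>auto simp: r_def\<close>)
    show "S_der M N x < S_der M N y" if "0 < x" "x < y" "y < 1 / r" for x y
    proof -
      have "0 < 1 - r * y" "1 - r * y < 1 - r * x" using that r by (auto simp: field_simps)
      then have "ln (1 - r * y) < ln (1 - r * x)" by (subst ln_less_cancel_iff) linarith+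
      then have "r * ln (1 - r * y) < r * ln (1 - r * x)" using r by simp
      moreover have "a * ln x < a * ln y" using that a by simp
      ultimately show ?thesis unfolding S by linarith
    qed
    have ln: "LIM x at_right 0. a * ln x :> at_bot"
      by (rule filterlim_tendsto_pos_mult_at_bot [OF tendsto_const a ln_at_0])
    have "((\<lambda>x. - (r * ln (1 - r * x))) \<longlongrightarrow> - (r * ln (1 - r * 0))) (at_right 0)"
      by (intro tendsto_intros) auto
    from iffD2 [OF filterlim_tendsto_add_at_bot_iff [OF this] ln]
    show "LIM x at_right 0. S_der M N x :> at_bot"
      unfolding S by simp
    have "((\<lambda>x. 1 - r * x) \<longlongrightarrow> 1 - r * (1 / r)) (at_left (1 / r))"
      by (intro tendsto_intros)
    moreover have "\<forall>\<^sub>F x in at_left (1 / r). 1 - r * x > 0"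
      using r by (auto simp: eventually_at_left_field field_simps intro!: exI [of _ 0])
    ultimately have "LIM x at_left (1 / r). 1 - r * x :> at_right 0"
      using r by (intro filterlim_at_withinI) (auto elim: eventually_mono)
    from filterlim_compose [OF ln_at_0 this]
    have "LIM x at_left (1 / r). r * ln (1 - r * x) :> at_bot"
      using r by (intro filterlim_tendsto_pos_mult_at_bot [OF tendsto_const]) auto
    then have "LIM x at_left (1 / r). - (r * ln (1 - r * x)) :> at_top"
      by (simp add: filterlim_uminus_at_bot)
    moreover have "((\<lambda>x. a * ln x) \<longlongrightarrow> a * ln (1 / r)) (at_left (1 / r))"
      using r by (intro tendsto_intros) auto
    ultimately show "LIM x at_left (1 / r). S_der M N x :> at_top"
      unfolding S using filterlim_tendsto_add_at_top
        [of "\<lambda>x. a * ln x" _ _ "\<lambda>x. - (r * ln (1 - r * x))"] by simp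
  qed
qed

section \<open>The periodic grid\<close>

text \<open>Wrapping round replaces the ghost indices \<open>0\<close> and \<open>m + 1\<close>, so
  only the cells themselves become vertices.\<close>

definition cyc_suc :: "nat \<Rightarrow> nat \<Rightarrow> nat" where
  "cyc_suc m i = (if i = m then 1 else i + 1)"

definition cyc_pred :: "nat \<Rightarrow> nat \<Rightarrow> nat" where
  "cyc_pred m i = (if i = 1 then m else i - 1)"

text \<open>An edge of the discrete torus is stored as its first end point together with a flag that is
  true for horizontal edges.\<close>

definition torus_edges :: "nat \<Rightarrow> nat \<Rightarrow> ((nat \<times> nat) \<times> bool) set" where
  "torus_edges m n = cells m n \<times> UNIV"

definition torus_tgt :: "nat \<Rightarrow> nat \<Rightarrow> (nat \<times> nat) \<times> bool \<Rightarrow> nat \<times> nat" where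
  "torus_tgt m n = (\<lambda>((i, j), hor). if hor then (cyc_suc m i, j) else (i, cyc_suc n j))"

definition torus_weight :: "real \<Rightarrow> real \<Rightarrow> (nat \<times> nat) \<times> bool \<Rightarrow> real" where
  "torus_weight hx hy e = (if snd e then 1 / hx else 1 / hy)"

lemma cyc_suc_in: "i \<in> {1..m} \<Longrightarrow> cyc_suc m i \<in> {1..m}"
  and cyc_pred_in: "i \<in> {1..m} \<Longrightarrow> cyc_pred m i \<in> {1..m}"
  by (auto simp: cyc_suc_def cyc_pred_def)

lemma cyc_suc_eq_iff: "i \<in> {1..m} \<Longrightarrow> k \<in> {1..m} \<Longrightarrow> cyc_suc m k = i \<longleftrightarrow> k = cyc_pred m i"
  by (auto simp: cyc_suc_def cyc_pred_def)

lemma cyc_suc_pred: "i \<in> {1..k} \<Longrightarrow> cyc_suc k (cyc_pred k i) = i"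
  by (auto simp: cyc_suc_def cyc_pred_def)

text \<open>Ascend from \<open>i\<close> to \<open>m\<close>, step to 1, ascend to \<open>k\<close>.
  The map \<open>g\<close> embeds the cycle as a row or a column.\<close>

lemma cyc_suc_reaches:
  assumes step: "\<And>i. i \<in> {1..m} \<Longrightarrow> (g i, g (cyc_suc m i)) \<in> A" and ik: "i \<in> {1..m}" "k \<in> {1..m}"
  shows "(g i, g k) \<in> A\<^sup>*"
proof -
  have up: "(g i, g k) \<in> A\<^sup>*" if "i \<le> k" "1 \<le> i" "k \<le> m" for i k
    using that
  proof (induction rule: dec_induct)
    case (step l)
    then have "(g l, g (l + 1)) \<in> A" using assms(1) [of l] by (simp add: cyc_suc_def)
    with step show ?case by (simp add: rtrancl.rtrancl_into_rtrancl)
  qed simp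
  have "(g i, g m) \<in> A\<^sup>*" "(g 1, g k) \<in> A\<^sup>*" using ik by (auto intro!: up)
  moreover have "(g m, g 1) \<in> A" using step [of m] ik by (simp add: cyc_suc_def)
  ultimately show ?thesis by (meson converse_rtrancl_into_rtrancl rtrancl_trans)
qed

text \<open>Paths change the first index and then the second. For \<open>m = 1\<close> horizontal
  edges are loops; for \<open>m = 2\<close> two of them join the same pair of cells.\<close>

lemma network_torus:
  assumes "m > 0" "n > 0" "hx > 0" "hy > 0"
  shows "network (cells m n) (torus_edges m n) fst (torus_tgt m n) (torus_weight hx hy)"
proof
  show "finite (cells m n)" "finite (torus_edges m n)" "cells m n \<noteq> {}"
    using assms by (auto simp: cells_def torus_edges_def)
  fix e assume e: "e \<in> torus_edges m n"
  then show "fst e \<in> cells m n" "torus_tgt m n e \<in> cells m n"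
    using cyc_suc_in by (auto simp: cells_def torus_edges_def torus_tgt_def)
  show "0 < torus_weight hx hy e" using assms by (simp add: torus_weight_def)
next
  fix p q assume pq: "p \<in> cells m n" "q \<in> cells m n"
  obtain i j k l where ij: "p = (i, j)" "q = (k, l)" by fastforce
  define A where "A = (\<lambda>e. (fst e, torus_tgt m n e)) ` torus_edges m n"
  have A: "(fst e, torus_tgt m n e) \<in> A" if "e \<in> torus_edges m n" for e
    using that by (simp add: A_def)
  have "((i, j), (k, j)) \<in> A\<^sup>*"
  proof (rule cyc_suc_reaches [where g = "\<lambda>i. (i, j)" and m = m])
    fix i assume "i \<in> {1..m}"
    then show "((i, j), (cyc_suc m i, j)) \<in> A"
      using A [of "((i, j), True)"] pq ij by (simp add: torus_tgt_def torus_edges_def cells_def)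
  qed (use pq ij in \<open>auto simp: cells_def\<close>)
  moreover have "((k, j), (k, l)) \<in> A\<^sup>*"
  proof (rule cyc_suc_reaches [where g = "\<lambda>j. (k, j)" and m = n])
    fix j assume "j \<in> {1..n}"
    then show "((k, j), (k, cyc_suc n j)) \<in> A"
      using A [of "((k, j), False)"] pq ij by (simp add: torus_tgt_def torus_edges_def cells_def)
  qed (use pq ij in \<open>auto simp: cells_def\<close>)
  ultimately show "(p, q) \<in> ((\<lambda>e. (fst e, torus_tgt m n e)) ` torus_edges m n)\<^sup>*"
    unfolding ij A_def [symmetric] by (rule rtrancl_trans)
qed

lemma sum_torus_src:
  assumes "p \<in> cells m n"
  shows "(\<Sum>e | e \<in> torus_edges m n \<and> fst e = p. X e) = X (p, True) + (X (p, False) :: real)"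
proof -
  have "{e \<in> torus_edges m n. fst e = p} = {(p, True), (p, False)}"
    using assms by (auto simp: torus_edges_def)
  then show ?thesis by simp
qed

lemma sum_torus_tgt:
  assumes "(i, j) \<in> cells m n"
  shows "(\<Sum>e | e \<in> torus_edges m n \<and> torus_tgt m n e = (i, j). X e)
         = X ((cyc_pred m i, j), True) + (X ((i, cyc_pred n j), False) :: real)"
proof -
  have "{e \<in> torus_edges m n. torus_tgt m n e = (i, j)}
        = {((cyc_pred m i, j), True), ((i, cyc_pred n j), False)}"
    using assms cyc_pred_in [of i m] cyc_pred_in [of j n] cyc_suc_eq_iff [of i m] cyc_suc_eq_iff [of j n]
    by (auto simp: torus_edges_def torus_tgt_def cells_def split: if_splits)
  then show ?thesis by simp
qed

lemma periodic_cyc: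
  assumes "periodic m n \<psi>" "(i, j) \<in> cells m n"
  shows "\<psi> (Suc i, j) = \<psi> (cyc_suc m i, j)" "\<psi> (i, Suc j) = \<psi> (i, cyc_suc n j)"
    "\<psi> (i - Suc 0, j) = \<psi> (cyc_pred m i, j)" "\<psi> (i, j - Suc 0) = \<psi> (i, cyc_pred n j)"
  using assms by (auto simp: periodic_def cells_def cyc_suc_def cyc_pred_def)

section \<open>Grid operators as graph operators\<close>

locale torus =
  fixes m n :: nat and hx hy :: real
  assumes mn: "m > 0" "n > 0" and h: "hx > 0" "hy > 0"

sublocale torus \<subseteq> network "cells m n" "torus_edges m n" fst "torus_tgt m n" "torus_weight hx hy"
  by (rule network_torus [OF mn h])

context torus
begin

text \<open>The grid operators store the edge at \<open>i - 1/2\<close> under \<open>i - 1\<close>,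
  a ghost index when \<open>i = 1\<close>, the torus under \<open>cyc_pred m i\<close>; periodicity
  identifies the two.\<close>

lemma grad_eq:
  assumes "periodic m n \<psi>" "(i, j) \<in> cells m n"
  shows "grad \<psi> ((i, j), True) = Dx hx \<psi> (i, j)" "grad \<psi> ((cyc_pred m i, j), True) = Dx hx \<psi> (i - 1, j)"
    "grad \<psi> ((i, j), False) = Dy hy \<psi> (i, j)" "grad \<psi> ((i, cyc_pred n j), False) = Dy hy \<psi> (i, j - 1)"
  unfolding grad_def using assms(2) periodic_cyc [OF assms]
  by (simp_all add: Dx_def Dy_def torus_tgt_def torus_weight_def cyc_suc_pred cells_def)

lemma average_eq:
  assumes "periodic m n \<psi>" "(i, j) \<in> cells m n"
  shows "(k (\<psi> (i, j)) + k (\<psi> (torus_tgt m n ((i, j), True)))) / 2 = Ax (k \<circ> \<psi>) (i, j)"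
    "(k (\<psi> (cyc_pred m i, j)) + k (\<psi> (torus_tgt m n ((cyc_pred m i, j), True)))) / 2 = Ax (k \<circ> \<psi>) (i - 1, j)"
    "(k (\<psi> (i, j)) + k (\<psi> (torus_tgt m n ((i, j), False)))) / 2 = Ay (k \<circ> \<psi>) (i, j)"
    "(k (\<psi> (i, cyc_pred n j)) + k (\<psi> (torus_tgt m n ((i, cyc_pred n j), False)))) / 2 = Ay (k \<circ> \<psi>) (i, j - 1)"
  using assms(2) periodic_cyc [OF assms]
  by (simp_all add: Ax_def Ay_def torus_tgt_def cyc_suc_pred cells_def)

lemma laplace_h_eq:
  assumes "periodic m n \<psi>" and p: "p \<in> cells m n"
  shows "laplace_h hx hy \<psi> p = dvg (grad \<psi>) p"
proof -
  obtain i j where ij: "p = (i, j)" "(i, j) \<in> cells m n" using p by (cases p) auto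
  show ?thesis
    unfolding dvg_def ij(1) sum_torus_src [OF ij(2)] sum_torus_tgt [OF ij(2)] grad_eq [OF assms(1) ij(2)]
    by (simp add: laplace_h_def dx_def dy_def torus_weight_def diff_divide_distrib)
qed

lemma chem_pot_eq:
  assumes "periodic m n \<psi>" and p: "p \<in> cells m n"
  shows "chem_pot M N \<chi> hx hy \<phi> \<psi> p = S_der M N (\<psi> p) + energy_grad \<psi> p + H_der M N \<chi> (\<phi> p)"
proof -
  obtain i j where ij: "p = (i, j)" "(i, j) \<in> cells m n" using p by (cases p) auto
  show ?thesis
    unfolding energy_grad_def dvg_def ij(1) sum_torus_src [OF ij(2)] sum_torus_tgt [OF ij(2)]
      grad_eq [OF assms(1) ij(2)] fst_conv average_eq [OF assms(1) ij(2)]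
    by (simp add: chem_pot_def dx_def dy_def ax_def ay_def torus_weight_def
        add_divide_distrib diff_divide_distrib algebra_simps)
qed

end

section \<open>Periodic extension and return to the grid\<close>

definition periodic_extension :: "nat \<Rightarrow> nat \<Rightarrow> (nat \<times> nat \<Rightarrow> real) \<Rightarrow> nat \<times> nat \<Rightarrow> real" where
  "periodic_extension m n u =
     (let wrap = (\<lambda>m i. if i = 0 then m else if i = m + 1 then 1 else i)
      in restrict (\<lambda>(i, j). u (wrap m i, wrap n j)) (cells_bar m n))"

lemma periodic_extension_grid: "periodic_extension m n u \<in> grid_functions m n"
  unfolding periodic_extension_def grid_functions_def Let_def by auto

lemma periodic_extension_periodic:
  "m > 0 \<Longrightarrow> n > 0 \<Longrightarrow> periodic m n (periodic_extension m n u)"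
  by (auto simp: periodic_def periodic_extension_def cells_bar_def Let_def)

lemma periodic_extension_cells: "p \<in> cells m n \<Longrightarrow> periodic_extension m n u p = u p"
  by (auto simp: periodic_extension_def cells_bar_def cells_def Let_def)

lemma periodic_extension_self:
  assumes "m > 0" "n > 0" "periodic m n u" "p \<in> cells_bar m n"
  shows "periodic_extension m n u p = u p"
proof -
  obtain i j where p: "p = (i, j)" "i \<le> m + 1" "j \<le> n + 1"
    using assms(4) by (auto simp: cells_bar_def)
  define i' where "i' = (if i = 0 then m else if i = m + 1 then 1 else i)"
  define j' where "j' = (if j = 0 then n else if j = n + 1 then 1 else j)"
  \<comment> \<open>The order matters at the corners: \<open>periodic\<close> wraps the second index
    for every first index, ghost indices included, but the first index only for inner second
    indices.\<close>
  have "u (i, j) = u (i, j')" "u (i, j') = u (i', j')"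
    using assms(1-3) p by (auto simp: periodic_def i'_def j'_def)
  then show ?thesis
    using assms(4) p(1) by (simp add: periodic_extension_def Let_def i'_def j'_def)
qed

lemma periodic_extension_range:
  assumes "m > 0" "n > 0" "\<And>p. p \<in> cells m n \<Longrightarrow> u p \<in> A" "p \<in> cells_bar m n"
  shows "periodic_extension m n u p \<in> A"
  using assms by (auto simp: periodic_extension_def cells_bar_def cells_def Let_def)

text \<open>Periodicity fixes the ghost values, extensionality the values off the grid.\<close>

lemma grid_functions_eqI:
  assumes "m > 0" "n > 0" "u \<in> grid_functions m n" "u' \<in> grid_functions m n"
    "periodic m n u" "periodic m n u'" and eq: "\<And>p. p \<in> cells m n \<Longrightarrow> u p = u' p"
  shows "u = u'"
proof (rule PiE_ext)
  show "u \<in> cells_bar m n \<rightarrow>\<^sub>E UNIV" "u' \<in> cells_bar m n \<rightarrow>\<^sub>E UNIV"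
    using assms by (auto simp: grid_functions_def)
  fix p assume p: "p \<in> cells_bar m n"
  have "periodic_extension m n u p = periodic_extension m n u' p"
    using assms(1,2) p eq by (auto simp: periodic_extension_def cells_bar_def cells_def Let_def)
  then show "u p = u' p"
    using periodic_extension_self assms p by metis
qed

theorem theorem3p8:
  fixes M N \<chi> Lx Ly s :: real and m n :: nat
    and \<phi> :: "nat \<times> nat \<Rightarrow> real"
  assumes "M > 0" "N > 0" "\<chi> > 0" "Lx > 0" "Ly > 0"
    and "m > 0" "n > 0"
    and "s > 0"
    and "\<phi> \<in> grid_functions m n" "periodic m n \<phi>"
    and "\<forall>p \<in> cells_bar m n. \<phi> p \<in> {0 <..< 1 / rho M N}"
  shows "\<exists>!\<psi>. \<psi> \<in> grid_functions m n \<and> periodic m n \<psi>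
           \<and> (\<forall>p \<in> cells_bar m n. \<psi> p \<in> {0 <..< 1 / rho M N})
           \<and> (\<exists>\<mu> \<in> grid_functions m n. periodic m n \<mu>
                \<and> (\<forall>p \<in> cells m n.
                      \<mu> p = chem_pot M N \<chi> (Lx / real m) (Ly / real n) \<phi> \<psi> p)
                \<and> (\<forall>p \<in> cells m n.
                      \<psi> p - \<phi> p = s * laplace_h (Lx / real m) (Ly / real n) \<mu> p))"
    (is "\<exists>!\<psi>. ?solution \<psi>")
proof -
  interpret torus m n "Lx / real m" "Ly / real n"
    by unfold_locales (use assms in auto)
  interpret convex_splitting "cells m n" "torus_edges m n" fst "torus_tgt m n"
    "torus_weight (Lx / real m) (Ly / real n)" "1 / rho M N"
    "\<lambda>x. S_fun M N x - ((ln (alpha M N / tau M N) + 1) / tau M N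
               + (ln (beta M N / tau M N) + 1) / N - rho M N) * x" "S_der M N"
    "\<lambda>p. H_der M N \<chi> (\<phi> p)"
    by (rule convex_splitting_S [OF network_axioms assms(1,2)])
  have sub: "cells m n \<subseteq> cells_bar m n" by (auto simp: cells_def cells_bar_def)
  have pot: "chem_pot M N \<chi> (Lx / real m) (Ly / real n) \<phi> \<psi> p = potential \<psi> p"
    if "periodic m n \<psi>" "p \<in> cells m n" for \<psi> p
    using that by (simp add: chem_pot_eq potential_def)
  \<comment> \<open>Agreement on the cells suffices, since the graph gradient never reads ghost
    values.\<close>
  have lap: "laplace_h (Lx / real m) (Ly / real n) \<mu> p = dvg (grad \<nu>) p"
    if "periodic m n \<mu>" "\<And>p. p \<in> cells m n \<Longrightarrow> \<mu> p = \<nu> p" "p \<in> cells m n" for \<mu> \<nu> p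
    using that grad_cong [of \<mu> \<nu>] by (simp add: laplace_h_eq cong: dvg_cong)
  have "admissible \<phi>"
    using assms(11) sub by (auto simp: admissible_def)
  then obtain u where u: "admissible u"
    "\<And>p. p \<in> cells m n \<Longrightarrow> u p - \<phi> p = s * dvg (grad (potential u)) p"
    using solution_exists [OF assms(8)] by blast
  define \<psi> \<mu> where "\<psi> = periodic_extension m n u" and "\<mu> = periodic_extension m n (potential u)"
  have \<psi>: "\<psi> p = u p" and \<mu>: "\<mu> p = potential u p" if "p \<in> cells m n" for p
    using that by (auto simp: \<psi>_def \<mu>_def periodic_extension_cells)
  have per: "periodic m n \<psi>" "periodic m n \<mu>" "\<psi> \<in> grid_functions m n" "\<mu> \<in> grid_functions m n"
    using assms by (auto simp: \<psi>_def \<mu>_def periodic_extension_periodic periodic_extension_grid)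
  have "?solution \<psi>"
  proof (intro conjI per ballI bexI [of _ \<mu>])
    show "\<psi> p \<in> {0<..<1 / rho M N}" if "p \<in> cells_bar m n" for p
      unfolding \<psi>_def using assms u(1) that
      by (intro periodic_extension_range) (auto simp: admissible_def)
    show "\<mu> p = chem_pot M N \<chi> (Lx / real m) (Ly / real n) \<phi> \<psi> p" if "p \<in> cells m n" for p
      using that per by (simp add: pot \<mu> potential_cong [OF \<psi>])
    show "\<psi> p - \<phi> p = s * laplace_h (Lx / real m) (Ly / real n) \<mu> p" if "p \<in> cells m n" for p
      using that u(2) by (simp add: \<psi> lap [OF per(2) \<mu>])
  qed
  moreover have "\<psi>1 = \<psi>2" if sol: "?solution \<psi>1" "?solution \<psi>2" for \<psi>1 \<psi>2
  proof -
    \<comment> \<open>Any \<open>\<mu>\<close> accompanying a solution agrees with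
      \<open>potential \<psi>\<close> on the cells, so \<open>lap\<close> turns the scheme into the
      graph equation.\<close>
    have *: "admissible \<psi>" "\<And>p. p \<in> cells m n \<Longrightarrow> \<psi> p - \<phi> p = s * dvg (grad (potential \<psi>)) p"
      if "?solution \<psi>" for \<psi>
      using that sub by (auto simp: admissible_def pot lap [where \<nu> = "potential \<psi>"])
    show ?thesis
      using sol solution_unique [OF assms(8) *(1) [OF sol(1)] *(1) [OF sol(2)] *(2) [OF sol(1)] *(2) [OF sol(2)]]
      by (intro grid_functions_eqI [OF assms(6,7)]) auto
  qed
  ultimately show ?thesis by blast
qed

end
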